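(* Assume (R) and (Q) from the context. Let $L$ be an integer with $L\ge r_{\mathrm{loc}}(\theta^\star)$ (in particular $r_{\mathrm{loc}}(\theta^\star)<\infty$). Then for all $1\le k,\ell\le r_{\mathrm{loc}}(\theta^\star)$, every $h\in U_k$ and every $g\in U_\ell$, as $\mathrm{SNR}=\beta^2/\sigma^2\to0$ (with $\sigma$ fixed and $\beta\to0^+$), $$\big\langle h,\mathcal I_{\mathrm{GMoM}}^{(W)}(\theta^\star;\beta)g\big\rangle=\begin{cases}\dfrac{\mathrm{SNR}^k}{k!}\big\langle DT_k(\theta^\star)[h],DT_k(\theta^\star)[g]\big\rangle_F+O(\mathrm{SNR}^{k+1}),&k=\ell,\\[1.5ex] O\bigl(\mathrm{SNR}^{(k+\ell+1)/2}\bigr),&|k-\ell|=1,\\[1ex] O\bigl(\mathrm{SNR}^{(k+\ell+2)/2}\bigr),&|k-\ell|\ge2.\end{cases}$$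
   Context: Model. Fix integers $d,m\ge 1$ and $\sigma>0$. Let $(\mathcal Z,\mathcal F,\mu)$ be a probability space, $A:\mathcal Z\to\mathbb R^{d\times m}$ measurable, and $\Theta\subset\mathbb R^m$ a $C^2$ embedded submanifold of dimension $m$ (boundary allowed), with $\theta^\star$ an interior point of $\Theta$. For $\theta\in\mathbb R^m$, $\beta\ge0$ let $p_{\theta,\beta}(y)=\int_{\mathcal Z}\varphi_\sigma(y-\beta A(z)\theta)\,\mu(dz)$, where $\varphi_\sigma$ is the density of $\mathcal N(0,\sigma^2I_d)$. (R) $\Theta$ is compact; $\|A(z)\|_{\mathrm{op}}\le a_{\max}<\infty$ for $\mu$-a.e. $z$; and $\mathbb E_{Z\sim\mu}[A(Z)^\top A(Z)]$ is positive definite. Equivalence. $\theta\sim\theta'$ (for $\theta,\theta'\in\Theta$) if $A(Z)\theta$ and $A(Z)\theta'$ have the same law under $Z\sim\mu$. $[\theta]=\{\theta'\in\Theta:\theta'\sim\theta\}$. (Q) There is an open neighborhood $U_\star\subset\Theta$ of $\theta^\star$ such that $U_\star/{\sim}$ admits a $C^2$ manifold structure for which the canonical projection $U_\star\to U_\star/{\sim}$ is a $C^2$ submersion. $T(\theta^\star)$ is the tangent space at $\theta^\star$ to $[\theta^\star]$ (velocities at $0$ of $C^1$ curves in $[\theta^\star]$ through $\theta^\star$ at time $0$), and $W=T(\theta^\star)^\perp\subset\mathbb R^m$. Moments and layers. $T_k(\theta)=\mathbb E_{Z\sim\mu}[(A(Z)\theta)^{\otimes k}]\in(\mathbb R^d)^{\otimes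 k}$; $DT_k(\theta^\star)[h]$ is its derivative at $\theta^\star$ in direction $h$; $\langle\cdot,\cdot\rangle_F$ is the Frobenius inner product of tensors. For $h\in W\setminus\{0\}$, $r(h)=\min\{j\ge1:DT_j(\theta^\star)[h]\ne0\}$ ($=\infty$ if none), and $r_{\mathrm{loc}}(\theta^\star)=\max_{h\in W\setminus\{0\}}r(h)$. Moment filtration: $V_1=W$, $V_k=\{h\in W:DT_j(\theta^\star)[h]=0\ \text{for all }j<k\}$ for $k\ge2$. Informative layers: $U_k=V_k\cap V_{k+1}^\perp$. Features. Hermite tensors: $H_k(x)=(-1)^ke^{\|x\|^2/2}\nabla_x^{\otimes k}e^{-\|x\|^2/2}$, a symmetric tensor in $(\mathbb R^d)^{\otimes k}$. Symmetric order-$j$ tensors are identified with their coordinate vectors in a fixed Frobenius-orthonormal basis of the space of symmetric order-$j$ tensors. $\psi(y)=(H_1(y/\sigma),\dots,H_L(y/\sigma))$ (stacked); $M(\theta;\beta)=\mathbb E_{Y\sim p_{\theta,\beta}}[\psi(Y)]=((\beta/\sigma)T_1(\theta),\dots,(\beta/\sigma)^LT_L(\theta))$; $\Sigma_L(\theta^\star;\beta)=\mathrm{Cov}_{Y\sim p_{\theta^\star,\beta}}(\psi(Y))$, invertible for all sufficiently small $\beta>0$. GMoM information. With $D_WM(\theta^\star;\beta)=DM(\theta^\star;\beta)|_W$ (derivative in $\theta$ restricted to $W$), $\mathcal I_{\mathrm{GMoM}}^{(W)}(\theta^\star;\beta)=D_WM(\theta^\star;\beta)^\top\Sigma_L(\theta^\star;\beta)^{-1}D_WM(\theta^\star;\beta):W\to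 W$. *)

theory Defs
  imports "HOL-Probability.Probability" "HOL-Library.Landau_Symbols"
begin

text \<open>Derivatives are taken within \<open>S\<close>, so that the definition applies both to open sets
  and to relatively open subsets of a linear subspace. In the latter case the derivative is
  determined only on the subspace, and the definition agrees with the intrinsic notion (extend
  the derivatives by the orthogonal projection). It is used only for such \<open>S\<close>.\<close>

definition C2_on :: "'a::euclidean_space set \<Rightarrow> ('a \<Rightarrow> 'b::real_normed_vector) \<Rightarrow> bool" where
  "C2_on S f \<longleftrightarrow>
     (\<exists>(f' :: 'a \<Rightarrow> 'a \<Rightarrow>\<^sub>L 'b) (f'' :: 'a \<Rightarrow> 'a \<Rightarrow>\<^sub>L ('a \<Rightarrow>\<^sub>L 'b)).
        (\<forall>x\<in>S. (f has_derivative blinfun_apply (f' x)) (at x within S)) \<and>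
        (\<forall>x\<in>S. (f' has_derivative blinfun_apply (f'' x)) (at x within S)) \<and>
        continuous_on S f'')"

text \<open>Embedded submanifolds, possibly with boundary, of dimension \<open>n\<close>: ambient charts
  straighten the set to a piece of an \<open>n\<close>-dimensional subspace or half-subspace.\<close>

definition C2_submanifold :: "nat \<Rightarrow> 'a::euclidean_space set \<Rightarrow> bool" where
  "C2_submanifold n S \<longleftrightarrow>
     (\<forall>p\<in>S. \<exists>V V' (\<phi> :: 'a \<Rightarrow> 'a) \<psi> E.
        open V \<and> p \<in> V \<and> open V' \<and> homeomorphism V V' \<phi> \<psi> \<and>
        C2_on V \<phi> \<and> C2_on V' \<psi> \<and> subspace E \<and> dim E = n \<and>
        (\<phi> ` (V \<inter> S) = V' \<inter> E \<or>
         (\<exists>e\<in>E - {0}. \<phi> ` (V \<inter> S) = V' \<inter> {x \<in> E. 0 \<le> e \<bullet> x})))"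

text \<open>An abstract C2 manifold without boundary: a topology \<open>X\<close> with an atlas \<open>C\<close> of charts
  \<open>(D, \<phi>)\<close> onto relatively open subsets of a fixed linear subspace \<open>E\<close> of a Euclidean space.
  Letting the model space be a subspace allows the dimension to be quantified.\<close>

definition C2_manifold ::
    "'x topology \<Rightarrow> 'e::euclidean_space set \<Rightarrow> ('x set \<times> ('x \<Rightarrow> 'e)) set \<Rightarrow> bool" where
  "C2_manifold X E C \<longleftrightarrow>
     Hausdorff_space X \<and> second_countable X \<and> subspace E \<and>
     (\<forall>(D, \<phi>)\<in>C. openin X D \<and> openin (top_of_set E) (\<phi> ` D) \<and>
        homeomorphic_map (subtopology X D) (top_of_set (\<phi> ` D)) \<phi>) \<and>
     (\<Union>(D, \<phi>)\<in>C. D) = topspace X \<and>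
     (\<forall>(D, \<phi>)\<in>C. \<forall>(D', \<phi>')\<in>C. C2_on (\<phi> ` (D \<inter> D')) (\<phi>' \<circ> inv_into D \<phi>))"

definition C2_submersion ::
    "'a::euclidean_space set \<Rightarrow> 'x topology \<Rightarrow> 'e::euclidean_space set \<Rightarrow>
     ('x set \<times> ('x \<Rightarrow> 'e)) set \<Rightarrow> ('a \<Rightarrow> 'x) \<Rightarrow> bool" where
  "C2_submersion U X E C f \<longleftrightarrow>
     continuous_map (top_of_set U) X f \<and>
     (\<forall>(D, \<phi>)\<in>C. C2_on (U \<inter> f -` D) (\<phi> \<circ> f) \<and>
        (\<forall>x\<in>U \<inter> f -` D. range (frechet_derivative (\<phi> \<circ> f) (at x)) = E))"

text \<open>Throughout, \<open>d = CARD('d)\<close> and \<open>m = CARD('m)\<close>.\<close>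

definition gauss_density :: "real \<Rightarrow> real^'d \<Rightarrow> real" where
  "gauss_density \<sigma> y =
     exp (- (norm y)\<^sup>2 / (2 * \<sigma>\<^sup>2)) / (2 * pi * \<sigma>\<^sup>2) powr (real CARD('d) / 2)"

definition obs_density ::
    "'z measure \<Rightarrow> ('z \<Rightarrow> real^'m^'d) \<Rightarrow> real \<Rightarrow> real^'m \<Rightarrow> real \<Rightarrow> real^'d \<Rightarrow> real" where
  "obs_density \<mu> A \<sigma> \<theta> \<beta> y = (\<integral>z. gauss_density \<sigma> (y - \<beta> *\<^sub>R (A z *v \<theta>)) \<partial>\<mu>)"

definition obs_law ::
    "'z measure \<Rightarrow> ('z \<Rightarrow> real^'m^'d) \<Rightarrow> real \<Rightarrow> real^'m \<Rightarrow> real \<Rightarrow> (real^'d) measure" where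
  "obs_law \<mu> A \<sigma> \<theta> \<beta> = density lborel (\<lambda>y. ennreal (obs_density \<mu> A \<sigma> \<theta> \<beta> y))"

definition positive_definite :: "real^'m^'m \<Rightarrow> bool" where
  "positive_definite G \<longleftrightarrow> transpose G = G \<and> (\<forall>x. x \<noteq> 0 \<longrightarrow> 0 < x \<bullet> (G *v x))"

definition condition_R :: "'z measure \<Rightarrow> ('z \<Rightarrow> real^'m^'d) \<Rightarrow> (real^'m) set \<Rightarrow> bool" where
  "condition_R \<mu> A \<Theta> \<longleftrightarrow>
     compact \<Theta> \<and>
     (\<exists>amax. AE z in \<mu>. onorm ((*v) (A z)) \<le> amax) \<and>
     positive_definite (\<integral>z. transpose (A z) ** A z \<partial>\<mu>)"

definition law_equiv :: "'z measure \<Rightarrow> ('z \<Rightarrow> real^'m^'d) \<Rightarrow> real^'m \<Rightarrow> real^'m \<Rightarrow> bool" where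
  "law_equiv \<mu> A \<theta> \<theta>' \<longleftrightarrow>
     distr \<mu> borel (\<lambda>z. A z *v \<theta>) = distr \<mu> borel (\<lambda>z. A z *v \<theta>')"

definition law_rel ::
    "'z measure \<Rightarrow> ('z \<Rightarrow> real^'m^'d) \<Rightarrow> (real^'m) set \<Rightarrow> ((real^'m) \<times> (real^'m)) set" where
  "law_rel \<mu> A U = {(\<theta>, \<theta>'). \<theta> \<in> U \<and> \<theta>' \<in> U \<and> law_equiv \<mu> A \<theta> \<theta>'}"

text \<open>The model space \<open>E\<close> of the quotient manifold is taken inside the parameter space; since
  the projection is a submersion, its dimension is at most \<open>m\<close>, so this is no restriction.\<close>

definition condition_Q ::
    "'z measure \<Rightarrow> ('z \<Rightarrow> real^'m^'d) \<Rightarrow> (real^'m) set \<Rightarrow> real^'m \<Rightarrow> bool" where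
  "condition_Q \<mu> A \<Theta> \<theta>s \<longleftrightarrow>
     (\<exists>U. open U \<and> \<theta>s \<in> U \<and> U \<subseteq> \<Theta> \<and>
        (\<exists>X (E :: (real^'m) set) C.
           topspace X = U // law_rel \<mu> A U \<and> C2_manifold X E C \<and>
           C2_submersion U X E C (\<lambda>\<theta>. law_rel \<mu> A U `` {\<theta>})))"

definition tangent_T ::
    "'z measure \<Rightarrow> ('z \<Rightarrow> real^'m^'d) \<Rightarrow> (real^'m) set \<Rightarrow> real^'m \<Rightarrow> (real^'m) set" where
  "tangent_T \<mu> A \<Theta> \<theta>s =
     {v. \<exists>\<gamma> \<epsilon>. 0 < \<epsilon> \<and> \<gamma> C1_differentiable_on {-\<epsilon><..<\<epsilon>} \<and>
          \<gamma> ` {-\<epsilon><..<\<epsilon>} \<subseteq> law_rel \<mu> A \<Theta> `` {\<theta>s} \<and> \<gamma> 0 = \<theta>s \<and>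
          (\<gamma> has_vector_derivative v) (at 0)}"

definition normal_W ::
    "'z measure \<Rightarrow> ('z \<Rightarrow> real^'m^'d) \<Rightarrow> (real^'m) set \<Rightarrow> real^'m \<Rightarrow> (real^'m) set" where
  "normal_W \<mu> A \<Theta> \<theta>s = orthogonal_comp (tangent_T \<mu> A \<Theta> \<theta>s)"

text \<open>A tensor of order \<open>k\<close> over \<open>real^'d\<close> is the family of its coordinates, indexed by the lists
  over \<open>'d\<close> of length \<open>k\<close> and extended by 0 to all other lists.\<close>

type_synonym 'd tensor = "'d list \<Rightarrow> real"

definition frob :: "nat \<Rightarrow> 'd::finite tensor \<Rightarrow> 'd tensor \<Rightarrow> real" where
  "frob k s t = (\<Sum>is | length is = k. s is * t is)"

definition tensor_power :: "nat \<Rightarrow> real^'d \<Rightarrow> 'd tensor" where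
  "tensor_power k x = (\<lambda>is. if length is = k then (\<Prod>i\<leftarrow>is. x $ i) else 0)"

definition moment_T ::
    "'z measure \<Rightarrow> ('z \<Rightarrow> real^'m^'d) \<Rightarrow> nat \<Rightarrow> real^'m \<Rightarrow> 'd tensor" where
  "moment_T \<mu> A k \<theta> = (\<lambda>is. \<integral>z. tensor_power k (A z *v \<theta>) is \<partial>\<mu>)"

definition DT ::
    "'z measure \<Rightarrow> ('z \<Rightarrow> real^'m^'d) \<Rightarrow> real^'m \<Rightarrow> nat \<Rightarrow> real^'m \<Rightarrow> 'd tensor" where
  "DT \<mu> A \<theta>s k h = (\<lambda>is. frechet_derivative (\<lambda>\<theta>. moment_T \<mu> A k \<theta> is) (at \<theta>s) h)"

definition r_dir ::
    "'z measure \<Rightarrow> ('z \<Rightarrow> real^'m^'d) \<Rightarrow> real^'m \<Rightarrow> real^'m \<Rightarrow> enat" where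
  "r_dir \<mu> A \<theta>s h =
     (if \<exists>j\<ge>1. DT \<mu> A \<theta>s j h \<noteq> (\<lambda>_. 0)
      then enat (LEAST j. 1 \<le> j \<and> DT \<mu> A \<theta>s j h \<noteq> (\<lambda>_. 0)) else \<infinity>)"

text \<open>The supremum is a maximum: the set of \<open>h\<close> with \<open>r_dir h \<ge> k\<close> is a decreasing chain of
  subspaces (with 0 added), so \<open>r_dir\<close> takes finitely many values.\<close>

definition r_loc ::
    "'z measure \<Rightarrow> ('z \<Rightarrow> real^'m^'d) \<Rightarrow> (real^'m) set \<Rightarrow> real^'m \<Rightarrow> enat" where
  "r_loc \<mu> A \<Theta> \<theta>s = (SUP h\<in>normal_W \<mu> A \<Theta> \<theta>s - {0}. r_dir \<mu> A \<theta>s h)"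

text \<open>\<open>layer_V\<close> is used for \<open>k \<ge> 1\<close>; at \<open>k = 1\<close> the condition is void and \<open>V\<^sub>1 = W\<close>.\<close>

definition layer_V ::
    "'z measure \<Rightarrow> ('z \<Rightarrow> real^'m^'d) \<Rightarrow> (real^'m) set \<Rightarrow> real^'m \<Rightarrow> nat \<Rightarrow> (real^'m) set" where
  "layer_V \<mu> A \<Theta> \<theta>s k =
     {h \<in> normal_W \<mu> A \<Theta> \<theta>s. \<forall>j. 1 \<le> j \<and> j < k \<longrightarrow> DT \<mu> A \<theta>s j h = (\<lambda>_. 0)}"

definition layer_U ::
    "'z measure \<Rightarrow> ('z \<Rightarrow> real^'m^'d) \<Rightarrow> (real^'m) set \<Rightarrow> real^'m \<Rightarrow> nat \<Rightarrow> (real^'m) set" where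
  "layer_U \<mu> A \<Theta> \<theta>s k =
     layer_V \<mu> A \<Theta> \<theta>s k \<inter> orthogonal_comp (layer_V \<mu> A \<Theta> \<theta>s (Suc k))"

primrec iter_partial :: "'d list \<Rightarrow> (real^'d \<Rightarrow> real) \<Rightarrow> real^'d \<Rightarrow> real" where
  "iter_partial [] f = f"
| "iter_partial (i # is) f = (\<lambda>x. frechet_derivative (iter_partial is f) (at x) (axis i 1))"

definition hermite :: "nat \<Rightarrow> real^'d \<Rightarrow> 'd tensor" where
  "hermite k x = (\<lambda>is. if length is = k
     then (-1) ^ k * exp ((norm x)\<^sup>2 / 2) * iter_partial is (\<lambda>x. exp (- (norm x)\<^sup>2 / 2)) x
     else 0)"

definition sym_tensors :: "nat \<Rightarrow> 'd tensor set" where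
  "sym_tensors j = {t. (\<forall>is. length is \<noteq> j \<longrightarrow> t is = 0) \<and>
                       (\<forall>is js. mset is = mset js \<longrightarrow> t is = t js)}"

definition sym_orthonormal_basis :: "nat \<Rightarrow> 'd::finite tensor set \<Rightarrow> bool" where
  "sym_orthonormal_basis j B \<longleftrightarrow>
     finite B \<and> B \<subseteq> sym_tensors j \<and>
     (\<forall>s\<in>B. \<forall>t\<in>B. frob j s t = (if s = t then 1 else 0)) \<and>
     (\<forall>t\<in>sym_tensors j. \<exists>c. t = (\<lambda>is. \<Sum>b\<in>B. c b * b is))"

text \<open>The coordinates of the stacked feature vector \<open>\<psi>\<close> are indexed by the pairs \<open>(j, b)\<close> with
  \<open>1 \<le> j \<le> L\<close> and \<open>b\<close> in the chosen orthonormal basis \<open>B j\<close>. Vectors and matrices over this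
  index set are functions that matter only there.\<close>

type_synonym 'd feat = "nat \<times> 'd tensor"

definition feats :: "nat \<Rightarrow> (nat \<Rightarrow> 'd tensor set) \<Rightarrow> 'd feat set" where
  "feats L B = Sigma {1..L} B"

definition psi :: "real \<Rightarrow> real^'d \<Rightarrow> 'd feat \<Rightarrow> real" where
  "psi \<sigma> y = (\<lambda>(j, b). frob j (hermite j (y /\<^sub>R \<sigma>)) b)"

definition mean_M ::
    "'z measure \<Rightarrow> ('z \<Rightarrow> real^'m^'d) \<Rightarrow> real \<Rightarrow> real^'m \<Rightarrow> real \<Rightarrow> 'd feat \<Rightarrow> real" where
  "mean_M \<mu> A \<sigma> \<theta> \<beta> i = (\<integral>y. psi \<sigma> y i \<partial>obs_law \<mu> A \<sigma> \<theta> \<beta>)"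

definition cov_Sigma ::
    "'z measure \<Rightarrow> ('z \<Rightarrow> real^'m^'d) \<Rightarrow> real \<Rightarrow> real^'m \<Rightarrow> real \<Rightarrow> 'd feat \<Rightarrow> 'd feat \<Rightarrow> real" where
  "cov_Sigma \<mu> A \<sigma> \<theta> \<beta> i j =
     (\<integral>y. (psi \<sigma> y i - mean_M \<mu> A \<sigma> \<theta> \<beta> i) * (psi \<sigma> y j - mean_M \<mu> A \<sigma> \<theta> \<beta> j)
        \<partial>obs_law \<mu> A \<sigma> \<theta> \<beta>)"

definition DM ::
    "'z measure \<Rightarrow> ('z \<Rightarrow> real^'m^'d) \<Rightarrow> real \<Rightarrow> real^'m \<Rightarrow> real \<Rightarrow> real^'m \<Rightarrow> 'd feat \<Rightarrow> real" where
  "DM \<mu> A \<sigma> \<theta>s \<beta> h i = frechet_derivative (\<lambda>\<theta>. mean_M \<mu> A \<sigma> \<theta> \<beta> i) (at \<theta>s) h"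

text \<open>The inverse of a matrix over a finite index set \<open>I\<close>; its entries on \<open>I\<close> are determined
  if the matrix is invertible and unspecified otherwise.\<close>

definition inverse_on :: "'i set \<Rightarrow> ('i \<Rightarrow> 'i \<Rightarrow> real) \<Rightarrow> 'i \<Rightarrow> 'i \<Rightarrow> real" where
  "inverse_on I S = (SOME S'. \<forall>i\<in>I. \<forall>j\<in>I.
      (\<Sum>k\<in>I. S i k * S' k j) = (if i = j then 1 else 0) \<and>
      (\<Sum>k\<in>I. S' i k * S k j) = (if i = j then 1 else 0))"

text \<open>The transpose of a linear map \<open>D\<close> from a subspace \<open>W\<close> to the vectors over \<open>I\<close>, applied to
  \<open>x\<close>.\<close>

definition transpose_on ::
    "'a::euclidean_space set \<Rightarrow> 'i set \<Rightarrow> ('a \<Rightarrow> 'i \<Rightarrow> real) \<Rightarrow> ('i \<Rightarrow> real) \<Rightarrow> 'a" where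
  "transpose_on W I D x = (THE v. v \<in> W \<and> (\<forall>h\<in>W. h \<bullet> v = (\<Sum>i\<in>I. D h i * x i)))"

definition gmom_info ::
    "'z measure \<Rightarrow> ('z \<Rightarrow> real^'m^'d) \<Rightarrow> real \<Rightarrow> (real^'m) set \<Rightarrow> nat \<Rightarrow>
     (nat \<Rightarrow> 'd tensor set) \<Rightarrow> real^'m \<Rightarrow> real \<Rightarrow> real^'m \<Rightarrow> real^'m" where
  "gmom_info \<mu> A \<sigma> \<Theta> L B \<theta>s \<beta> g =
     (let I = feats L B; D = DM \<mu> A \<sigma> \<theta>s \<beta>;
          S' = inverse_on I (cov_Sigma \<mu> A \<sigma> \<theta>s \<beta>)
      in transpose_on (normal_W \<mu> A \<Theta> \<theta>s) I D (\<lambda>i. \<Sum>j\<in>I. S' i j * D g j))"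

definition snr :: "real \<Rightarrow> real \<Rightarrow> real" where
  "snr \<sigma> \<beta> = \<beta>\<^sup>2 / \<sigma>\<^sup>2"

end

theory Submission
  imports Defs "HOL-Computational_Algebra.Polynomial" "HOL-Combinatorics.Multiset_Permutations"
begin

text \<open>With \<open>t = \<beta> / \<sigma>\<close>, the covariance of the Hermite features is \<open>diag (j!) + O(t)\<close>: the
  correlation of two Hermite polynomials of orders \<open>m\<close>, \<open>n\<close> under a Gaussian with mean \<open>a\<close> is
  \<open>a ^ \<bar>m - n\<bar>\<close> times a polynomial in \<open>a\<^sup>2\<close>, so a block \<open>(i, j)\<close> has a term of order \<open>t\<close> only if
  \<open>\<bar>i - j\<bar> = 1\<close>. The inverse covariance inherits this structure. For \<open>h\<close> in layer \<open>k\<close> and \<open>g\<close>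
  in layer \<open>l\<close>, only the blocks \<open>i \<ge> k\<close>, \<open>j \<ge> l\<close> contribute, with weight \<open>t ^ (i + j)\<close>; counting
  powers of \<open>t\<close> gives the claim.\<close>

text \<open>An entry of a Hermite tensor depends only on how often each coordinate occurs in its
  index list, and factors over the coordinates; so, given \<open>z\<close>, every moment of the
  features is a combination of products of one-variable Gaussian means. These come from integration
  by parts, proved for polynomials by induction. The obstacle is the error of order \<open>t\<close>
  in adjacent blocks, which by itself would only give the exponent \<open>k + l + 1\<close>. If
  \<open>|k - l| \<noteq> 1\<close>, the pair \<open>(k, l)\<close> is not adjacent, so an adjacent
  pair with \<open>i \<ge> k\<close>, \<open>j \<ge> l\<close> has
  \<open>i + j \<ge> k + l + 1\<close> and reaches \<open>k + l + 2\<close> all the same. The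
  diagonal limit of the inverse covariance contributes \<open>2 * i\<close> with
  \<open>i \<ge> max k l\<close>, which exceeds \<open>k + l\<close> by at least
  \<open>|k - l|\<close>; for \<open>k = l\<close> the block \<open>i = k\<close> is the leading
  term and the next one has exponent \<open>2 * k + 2\<close>.\<close>

section \<open>Gaussian means and Hermite polynomials in one variable\<close>

text \<open>The weight \<open>x ^ k\<close> lets the induction on \<open>p\<close> go through.\<close>

definition gauss_moment :: "nat \<Rightarrow> real poly \<Rightarrow> real \<Rightarrow> real" where
  "gauss_moment k p a = (\<integral>x. std_normal_density x * (x ^ k * poly p (x + a)) \<partial>lborel)"

abbreviation gauss_mean :: "real poly \<Rightarrow> real \<Rightarrow> real" where
  "gauss_mean \<equiv> gauss_moment 0"

lemma gauss_moment_integrable [simp]: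
  "integrable lborel (\<lambda>x. std_normal_density x * (x ^ k * poly p (x + a)))"
proof (induction p arbitrary: k)
  case 0
  then show ?case by simp
next
  case (pCons c p)
  have "(\<lambda>x. std_normal_density x * (x ^ k * poly (pCons c p) (x + a))) =
     (\<lambda>x. c * (std_normal_density x * x ^ k) + std_normal_density x * (x ^ Suc k * poly p (x + a))
        + a * (std_normal_density x * (x ^ k * poly p (x + a))))"
    by (simp add: fun_eq_iff algebra_simps)
  then show ?case
    using pCons.IH integrable_std_normal_moment
    by (simp del: power_Suc)
qed

lemma gauss_moment_0 [simp]: "gauss_moment k 0 a = 0"
  by (simp add: gauss_moment_def)

lemma gauss_moment_add: "gauss_moment k (p + q) a = gauss_moment k p a + gauss_moment k q a"
proof -
  have "gauss_moment k (p + q) a = (\<integral>x. std_normal_density x * (x ^ k * poly p (x + a)) +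
      std_normal_density x * (x ^ k * poly q (x + a)) \<partial>lborel)"
    unfolding gauss_moment_def by (intro Bochner_Integration.integral_cong) (auto simp: algebra_simps)
  then show ?thesis
    by (simp add: Bochner_Integration.integral_add [OF gauss_moment_integrable gauss_moment_integrable]
        gauss_moment_def)
qed

lemma gauss_moment_smult: "gauss_moment k (smult c p) a = c * gauss_moment k p a"
  by (simp add: gauss_moment_def mult.left_commute)

lemma gauss_moment_pCons:
  "gauss_moment k (pCons c p) a = c * gauss_moment k 1 0 + gauss_moment (Suc k) p a + a * gauss_moment k p a"
proof -
  have "gauss_moment k (pCons c p) a =
     (\<integral>x. c * (std_normal_density x * (x ^ k * poly 1 (x + 0))) +
        std_normal_density x * (x ^ Suc k * poly p (x + a))
        + a * (std_normal_density x * (x ^ k * poly p (x + a))) \<partial>lborel)"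
    unfolding gauss_moment_def by (intro Bochner_Integration.integral_cong) (auto simp: algebra_simps)
  also have "\<dots> = c * gauss_moment k 1 0 + gauss_moment (Suc k) p a + a * gauss_moment k p a"
    unfolding gauss_moment_def
    by (subst Bochner_Integration.integral_add Bochner_Integration.integral_mult_right_zero,
        (intro Bochner_Integration.integrable_add integrable_mult_right gauss_moment_integrable)+)+ simp
  finally show ?thesis .
qed

text \<open>Supplies continuity in \<open>a\<close>, from which the measurability of correlations
  and the bounds on balls are drawn later.\<close>

lemma gauss_moment_poly: "\<exists>Q. \<forall>a. gauss_moment k p a = poly Q a"
proof (induction p arbitrary: k)
  case 0
  have "\<forall>a. gauss_moment k 0 a = poly 0 a" by simp
  then show ?case by blast
next
  case (pCons c p)
  obtain Q1 Q2 where "\<forall>a. gauss_moment k p a = poly Q1 a" "\<forall>a. gauss_moment (Suc k) p a = poly Q2 a"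
    using pCons.IH by metis
  then have "\<forall>a. gauss_moment k (pCons c p) a =
      poly ([:c * gauss_moment k 1 0:] + Q2 + [:0, 1:] * Q1) a"
    by (simp add: gauss_moment_pCons)
  then show ?case by blast
qed

lemma gauss_moment_1_even: "gauss_moment (2 * k) 1 a = fact (2 * k) / (2 ^ k * fact k)"
  using integral_std_normal_moment_even[of k] by (simp add: gauss_moment_def)

lemma gauss_moment_1_odd: "gauss_moment (2 * k + 1) 1 a = 0"
  using integral_std_normal_moment_odd[of k] by (simp add: gauss_moment_def)

lemma gauss_moment_1_Suc: "gauss_moment (Suc k) 1 a = real k * gauss_moment (k - 1) 1 a"
proof (cases "even k")
  case True
  then obtain j where k: "k = 2 * j" by (elim evenE)
  show ?thesis
  proof (cases j)
    case 0
    then show ?thesis using k gauss_moment_1_odd[of 0 a] by simp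
  next
    case (Suc i)
    then have "k - 1 = 2 * i + 1" using k by simp
    then show ?thesis using k gauss_moment_1_odd[of j a] gauss_moment_1_odd[of i a] by simp
  qed
next
  case False
  then obtain j where k: "k = 2 * j + 1" by (elim oddE)
  then have "gauss_moment (Suc k) 1 a = fact (2 * Suc j) / (2 ^ Suc j * fact (Suc j))"
    using gauss_moment_1_even[of "Suc j" a] by simp
  moreover have "gauss_moment (k - 1) 1 a = fact (2 * j) / (2 ^ j * fact j)"
    using k gauss_moment_1_even[of j a] by simp
  \<comment> \<open>Two new factors appear: \<open>2 * j + 1\<close>, which is \<open>k\<close>, and
    \<open>2 * (j + 1)\<close>, which cancels against the denominator.\<close>
  moreover have "fact (2 * Suc j) = (real k * fact (2 * j)) * (2 * real (Suc j))"
    using k by (simp add: algebra_simps)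
  moreover have "(2::real) ^ Suc j * fact (Suc j) = (2 ^ j * fact j) * (2 * real (Suc j))"
    by (simp add: algebra_simps)
  ultimately show ?thesis
    by (simp only:) simp
qed

text \<open>Gaussian integration by parts for \<open>x ^ k * p (x + a)\<close>, without analysis:
  peeling off the lowest coefficient of \<open>p\<close> reduces it to the pure moments in
  \<open>gauss_moment_1_Suc\<close>. At \<open>k = 0\<close> the truncated \<open>k - 1\<close> is
  multiplied by \<open>0\<close>.\<close>

lemma gauss_moment_Stein:
  "gauss_moment (Suc k) p a = real k * gauss_moment (k - 1) p a + gauss_moment k (pderiv p) a"
proof (induction p arbitrary: k)
  case 0
  then show ?case by simp
next
  case (pCons c p)
  have 1: "gauss_moment (Suc (Suc k)) p a = real (Suc k) * gauss_moment k p a + gauss_moment (Suc k) (pderiv p) a"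
    using pCons.IH[of "Suc k"] by simp
  show ?case
    using pCons.IH[of k] 1
    by (cases k) (simp_all add: gauss_moment_pCons pderiv_pCons gauss_moment_add gauss_moment_1_Suc algebra_simps)
qed

lemma gauss_mean_X_mult:
  "gauss_mean ([:0, 1:] * p) a = gauss_mean (pderiv p) a + a * gauss_mean p a"
  using gauss_moment_Stein[of 0 p a] by (simp add: gauss_moment_pCons)

text \<open>Probabilists' Hermite polynomials by the raising operator \<open>x - d/dx\<close>. Up to
  sign this is what differentiation does to the polynomial factor of
  \<open>p(u) * exp (- u\<^sup>2 / 2)\<close>, which links them to the Hermite tensors.\<close>

fun herm :: "nat \<Rightarrow> real poly" where
  "herm 0 = 1"
| "herm (Suc n) = [:0, 1:] * herm n - pderiv (herm n)"

lemma pderiv_X_mult: "pderiv ([:0, 1:] * p) = p + [:0, 1:] * pderiv p" for p :: "real poly"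
  by (simp add: pderiv_pCons)

lemma pderiv_herm: "pderiv (herm n) = smult (real n) (herm (n - 1))"
proof (induction n)
  case 0
  then show ?case by simp
next
  case (Suc n)
  have "pderiv (herm (Suc n)) = herm n + [:0, 1:] * pderiv (herm n) - pderiv (pderiv (herm n))"
    by (simp only: herm.simps pderiv_diff pderiv_X_mult)
  \<comment> \<open>By the induction hypothesis, used before the second differentiation. For
    \<open>n > 0\<close> the bracket is the recursion for \<open>herm n\<close>; for
    \<open>n = 0\<close> its coefficient vanishes.\<close>
  also have "\<dots> = herm n + smult (real n) ([:0, 1:] * herm (n - 1) - pderiv (herm (n - 1)))"
    by (simp add: Suc.IH pderiv_smult smult_diff_right)
  also have "\<dots> = smult (real (Suc n)) (herm n)"
  proof (cases n)
    case (Suc j)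
    then have "[:0, 1:] * herm (n - 1) - pderiv (herm (n - 1)) = herm n" by simp
    then show ?thesis by (simp only: of_nat_Suc smult_add_left) simp
  qed simp
  finally show ?case by simp
qed

definition herm_corr :: "nat \<Rightarrow> nat \<Rightarrow> real \<Rightarrow> real" where
  "herm_corr m n a = gauss_mean (herm m * herm n) a"

lemma herm_corr_commute: "herm_corr m n = herm_corr n m"
  by (simp add: herm_corr_def fun_eq_iff mult.commute)

lemma herm_corr_0_0 [simp]: "herm_corr 0 0 a = 1"
  by (simp add: herm_corr_def gauss_moment_def)

text \<open>Integration by parts for \<open>herm m * herm n\<close>: the derivative falling on
  \<open>herm m\<close> cancels against the one subtracted in the recursion for
  \<open>herm (Suc m)\<close>, and the derivative falling on \<open>herm n\<close> lowers its
  order.\<close>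

lemma herm_corr_Suc: "herm_corr (Suc m) n a = real n * herm_corr m (n - 1) a + a * herm_corr m n a"
proof -
  have "herm (Suc m) * herm n + pderiv (herm m) * herm n = [:0, 1:] * (herm m * herm n)"
    by (simp only: herm.simps) (simp add: algebra_simps)
  from arg_cong[OF this, of "\<lambda>p. gauss_mean p a"]
  have "herm_corr (Suc m) n a + gauss_mean (pderiv (herm m) * herm n) a =
      gauss_mean (pderiv (herm m * herm n)) a + a * herm_corr m n a"
    unfolding gauss_moment_add gauss_mean_X_mult herm_corr_def .
  moreover have "gauss_mean (pderiv (herm m * herm n)) a =
      gauss_mean (pderiv (herm m) * herm n) a + real n * herm_corr m (n - 1) a"
    by (simp only: pderiv_mult gauss_moment_add herm_corr_def pderiv_herm)
       (simp add: gauss_moment_smult mult.commute)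
  ultimately show ?thesis by simp
qed

lemma herm_corr_0_left [simp]: "herm_corr 0 n a = a ^ n"
proof (induction n)
  case (Suc n)
  have "herm_corr 0 (Suc n) a = herm_corr (Suc n) 0 a" by (simp add: herm_corr_commute)
  also have "\<dots> = a * herm_corr 0 n a" by (simp add: herm_corr_Suc herm_corr_commute[of n 0])
  finally show ?case using Suc by simp
qed simp

lemma gauss_mean_herm: "gauss_mean (herm n) a = a ^ n"
  using herm_corr_0_left[of n a] by (simp add: herm_corr_def)

text \<open>In \<open>herm_corr_Suc\<close> the first term lowers both orders and keeps their
  difference; the second pays one factor \<open>a\<close> and lowers only the left order. For
  \<open>n \<le> m\<close> that factor makes up exactly the lost power of \<open>a\<close>; for
  \<open>m < n\<close> there is a surplus \<open>a\<^sup>2\<close>, absorbed into the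
  polynomial.\<close>

lemma herm_corr_form: "\<exists>Q. \<forall>a. herm_corr m n a = a ^ nat \<bar>int m - int n\<bar> * poly Q (a\<^sup>2)"
proof (induction m arbitrary: n)
  case 0
  have "\<forall>a. herm_corr 0 n a = a ^ nat \<bar>int 0 - int n\<bar> * poly 1 (a\<^sup>2)" by simp
  then show ?case by blast
next
  case (Suc m)
  obtain Q1 where Q1: "\<And>a. herm_corr m (n - 1) a = a ^ nat \<bar>int m - int (n - 1)\<bar> * poly Q1 (a\<^sup>2)"
    using Suc by metis
  obtain Q2 where Q2: "\<And>a. herm_corr m n a = a ^ nat \<bar>int m - int n\<bar> * poly Q2 (a\<^sup>2)"
    using Suc by metis
  consider "n = 0" | "1 \<le> n" "n \<le> m" | "m < n" by linarith
  then show ?case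
  proof cases
    case 1
    then have "\<forall>a. herm_corr (Suc m) n a = a ^ nat \<bar>int (Suc m) - int n\<bar> * poly Q2 (a\<^sup>2)"
      using Q2 by (simp add: herm_corr_Suc nat_add_distrib)
    then show ?thesis by blast
  next
    case 2
    then have e: "nat \<bar>int (Suc m) - int n\<bar> = Suc (m - n)" "nat \<bar>int m - int (n - 1)\<bar> = Suc (m - n)"
      "nat \<bar>int m - int n\<bar> = m - n" by linarith+
    have "\<forall>a. herm_corr (Suc m) n a = a ^ nat \<bar>int (Suc m) - int n\<bar> * poly (smult (real n) Q1 + Q2) (a\<^sup>2)"
      unfolding herm_corr_Suc Q1 Q2 e by (simp add: algebra_simps)
    then show ?thesis by blast
  next
    case 3
    then have e: "nat \<bar>int (Suc m) - int n\<bar> = n - Suc m" "nat \<bar>int m - int (n - 1)\<bar> = n - Suc m"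
      "nat \<bar>int m - int n\<bar> = Suc (n - Suc m)" by linarith+
    have "\<forall>a. herm_corr (Suc m) n a = a ^ nat \<bar>int (Suc m) - int n\<bar> * poly (smult (real n) Q1 + [:0, 1:] * Q2) (a\<^sup>2)"
      unfolding herm_corr_Suc Q1 Q2 e by (simp add: algebra_simps power2_eq_square)
    then show ?thesis by blast
  qed
qed

lemma herm_corr_diag_0: "herm_corr n n 0 = fact n"
  by (induction n) (simp_all add: herm_corr_Suc)

text \<open>A polynomial in \<open>a\<^sup>2\<close> has no linear term in \<open>a\<close>, so the
  first correction to the value at \<open>a = 0\<close> is quadratic. This is why diagonal blocks
  have no error of order \<open>t\<close>.\<close>

lemma herm_corr_diag_form: "\<exists>Q. \<forall>a. herm_corr n n a = fact n + a\<^sup>2 * poly Q (a\<^sup>2)"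
proof -
  obtain Q where Q: "\<And>a. herm_corr n n a = poly Q (a\<^sup>2)"
    using herm_corr_form[of n n] by auto
  obtain c q where "Q = pCons c q" by (cases Q)
  moreover from this have "c = fact n" using Q[of 0] by (simp add: herm_corr_diag_0)
  ultimately show ?thesis using Q by (intro exI[of _ q]) simp
qed

section \<open>Bounds for one-variable correlations, uniform over bounded means\<close>

lemma poly_bounded:
  fixes p :: "real poly"
  shows "\<exists>C>0. \<forall>x. \<bar>x\<bar> \<le> R \<longrightarrow> \<bar>poly p x\<bar> \<le> C"
proof -
  have "compact ((\<lambda>x. poly p x) ` {-R..R})"
    by (intro compact_continuous_image continuous_intros) auto
  then obtain C where "C > 0" "\<forall>y\<in>(\<lambda>x. poly p x) ` {-R..R}. norm y \<le> C"
    using compact_imp_bounded bounded_pos by blast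
  then show ?thesis by (intro exI[of _ C]) (auto simp: abs_le_iff)
qed

lemma herm_corr_bound:
  "\<exists>C>0. \<forall>a. \<bar>a\<bar> \<le> R \<longrightarrow> \<bar>herm_corr m n a\<bar> \<le> C * \<bar>a\<bar> ^ nat \<bar>int m - int n\<bar>"
proof -
  obtain Q where Q: "\<And>a. herm_corr m n a = a ^ nat \<bar>int m - int n\<bar> * poly Q (a\<^sup>2)"
    using herm_corr_form by metis
  obtain C where C: "C > 0" "\<And>x. \<bar>x\<bar> \<le> R\<^sup>2 \<Longrightarrow> \<bar>poly Q x\<bar> \<le> C" using poly_bounded[of "R\<^sup>2"] by metis
  have "\<bar>herm_corr m n a\<bar> \<le> C * \<bar>a\<bar> ^ nat \<bar>int m - int n\<bar>" if "\<bar>a\<bar> \<le> R" for a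
  proof -
    have "a\<^sup>2 \<le> R\<^sup>2" using that by (simp add: abs_le_square_iff [symmetric])
    then have "\<bar>poly Q (a\<^sup>2)\<bar> \<le> C" by (intro C(2)) simp
    then show ?thesis by (simp add: Q abs_mult power_abs mult.commute[of C] mult_left_mono)
  qed
  then show ?thesis using C(1) by blast
qed

lemma herm_corr_diag_bound:
  "\<exists>C>0. \<forall>a. \<bar>a\<bar> \<le> R \<longrightarrow> \<bar>herm_corr n n a - fact n\<bar> \<le> C * a\<^sup>2"
proof -
  obtain Q where Q: "\<And>a. herm_corr n n a = fact n + a\<^sup>2 * poly Q (a\<^sup>2)"
    using herm_corr_diag_form by metis
  obtain C where C: "C > 0" "\<And>x. \<bar>x\<bar> \<le> R\<^sup>2 \<Longrightarrow> \<bar>poly Q x\<bar> \<le> C" using poly_bounded[of "R\<^sup>2"] by metis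
  have "\<bar>herm_corr n n a - fact n\<bar> \<le> C * a\<^sup>2" if "\<bar>a\<bar> \<le> R" for a
  proof -
    have "a\<^sup>2 \<le> R\<^sup>2" using that by (simp add: abs_le_square_iff [symmetric])
    then have "\<bar>poly Q (a\<^sup>2)\<bar> \<le> C" by (intro C(2)) simp
    then show ?thesis by (simp add: Q abs_mult mult.commute[of C] mult_left_mono)
  qed
  then show ?thesis using C(1) by blast
qed

section \<open>Polynomials under a Gaussian mixture\<close>

lemma lborel_prod_Basis:
  fixes f :: "'a::euclidean_space \<Rightarrow> real \<Rightarrow> real"
  assumes int: "\<And>b. b \<in> Basis \<Longrightarrow> integrable lborel (f b)"
  shows "integrable lborel (\<lambda>x. \<Prod>b\<in>Basis. f b (x \<bullet> b))"
    and "(\<integral>x. (\<Prod>b\<in>Basis. f b (x \<bullet> b)) \<partial>lborel) = (\<Prod>b\<in>Basis. \<integral>x. f b x \<partial>lborel)"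
proof -
  interpret product_sigma_finite "\<lambda>b::'a. lborel :: real measure" ..
  have [measurable]: "f b \<in> borel_measurable borel" if "b \<in> Basis" for b
    using int[OF that] by auto
  have "integrable (\<Pi>\<^sub>M b\<in>(Basis::'a set). lborel) (\<lambda>x. \<Prod>b\<in>Basis. f b (x b))"
    using int by (intro product_integrable_prod) auto
  then show "integrable lborel (\<lambda>x. \<Prod>b\<in>Basis. f b (x \<bullet> b))"
    by (subst lborel_eq, subst integrable_distr_eq) auto
  have "(\<integral>x. (\<Prod>b\<in>Basis. f b (x \<bullet> b)) \<partial>lborel) =
      (\<integral>x. (\<Prod>b\<in>Basis. f b (x b)) \<partial>(\<Pi>\<^sub>M b\<in>(Basis::'a set). lborel))"
    by (subst lborel_eq, subst integral_distr) auto
  also have "\<dots> = (\<Prod>b\<in>Basis. \<integral>x. f b x \<partial>lborel)"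
    using int by (intro product_integral_prod) auto
  finally show "(\<integral>x. (\<Prod>b\<in>Basis. f b (x \<bullet> b)) \<partial>lborel) = (\<Prod>b\<in>Basis. \<integral>x. f b x \<partial>lborel)" .
qed

lemma lborel_prod_vec:
  fixes f :: "'d::finite \<Rightarrow> real \<Rightarrow> real"
  assumes int: "\<And>c. integrable lborel (f c)"
  shows "integrable lborel (\<lambda>x::real^'d. \<Prod>c\<in>UNIV. f c (x $ c))"
    and "(\<integral>x. (\<Prod>c\<in>UNIV. f c (x $ c)) \<partial>(lborel :: (real^'d) measure)) = (\<Prod>c\<in>UNIV. \<integral>x. f c x \<partial>lborel)"
proof -
  let ?e = "\<lambda>c::'d. axis c (1::real)"
  have inj: "inj ?e" by (simp add: inj_on_def axis_eq_axis)
  have B: "(Basis :: (real^'d) set) = range ?e" by (auto simp: Basis_vec_def)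
  have r: "(\<Prod>b\<in>Basis. G b) = (\<Prod>c\<in>UNIV. G (?e c))" for G :: "real^'d \<Rightarrow> real"
    unfolding B using inj by (subst prod.reindex) auto
  have i: "inv ?e (?e c) = c" for c using inj by (rule inv_f_f)
  \<comment> \<open>The factors are indexed by coordinates here and by basis vectors there;
    \<open>inv ?e\<close> translates.\<close>
  note L = lborel_prod_Basis[of "\<lambda>b. f (inv ?e b)", OF int]
  show "integrable lborel (\<lambda>x::real^'d. \<Prod>c\<in>UNIV. f c (x $ c))"
    using L(1) by (simp add: r i inner_axis)
  show "(\<integral>x. (\<Prod>c\<in>UNIV. f c (x $ c)) \<partial>(lborel :: (real^'d) measure)) = (\<Prod>c\<in>UNIV. \<integral>x. f c x \<partial>lborel)"
    using L(2) by (simp add: r i inner_axis)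
qed

lemma norm_vec_squared: "(norm x)\<^sup>2 = (\<Sum>c\<in>UNIV. (x $ c)\<^sup>2)" for x :: "real^'d"
  unfolding power2_norm_eq_inner by (simp add: inner_vec_def power2_eq_square)

lemma gauss_density_prod:
  fixes y w :: "real^'d"
  assumes "0 < \<sigma>"
  shows "gauss_density \<sigma> (y - w) = (\<Prod>c\<in>UNIV. normal_density (w $ c) \<sigma> (y $ c))"
proof -
  have e: "exp (- (norm (y - w))\<^sup>2 / (2 * \<sigma>\<^sup>2)) = (\<Prod>c\<in>UNIV. exp (- (y $ c - w $ c)\<^sup>2 / (2 * \<sigma>\<^sup>2)))"
    by (simp add: norm_vec_squared exp_sum [symmetric] sum_negf sum_divide_distrib)
  have p: "sqrt (2 * pi * \<sigma>\<^sup>2) ^ CARD('d) = (2 * pi * \<sigma>\<^sup>2) powr (real CARD('d) / 2)"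
  proof -
    have "sqrt (2 * pi * \<sigma>\<^sup>2) ^ CARD('d) = sqrt (2 * pi * \<sigma>\<^sup>2) powr real CARD('d)"
      using assms by (intro powr_realpow [symmetric]) simp
    also have "\<dots> = ((2 * pi * \<sigma>\<^sup>2) powr (1 / 2)) powr real CARD('d)"
      by (subst powr_half_sqrt) simp_all
    also have "\<dots> = (2 * pi * \<sigma>\<^sup>2) powr (real CARD('d) / 2)"
      by (simp only: powr_powr) simp
    finally show ?thesis .
  qed
  show ?thesis
    unfolding gauss_density_def normal_density_def e p[symmetric]
    by (simp add: prod_dividef)
qed

lemma normal_poly_integral:
  assumes "0 < \<sigma>"
  shows "integrable lborel (\<lambda>y. normal_density m \<sigma> y * poly p (y / \<sigma>))" (is "integrable _ ?f")
    and "(\<integral>y. normal_density m \<sigma> y * poly p (y / \<sigma>) \<partial>lborel) = gauss_mean p (m / \<sigma>)"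
proof -
  \<comment> \<open>The substitution \<open>y = m + \<sigma> * x\<close> leads to the standard
    normal with shift \<open>m / \<sigma>\<close>; its Jacobian will cancel the division by
    \<open>\<sigma>\<close>. The factor \<open>x ^ 0\<close> matches the form of
    \<open>gauss_moment 0\<close>.\<close>
  have e: "?f (m + \<sigma> * x) = (std_normal_density x * (x ^ 0 * poly p (x + m / \<sigma>))) / \<sigma>" for x
  proof -
    have "normal_density m \<sigma> (m + \<sigma> * x) = std_normal_density x / \<sigma>"
      using assms by (simp add: normal_density_def real_sqrt_mult power_mult_distrib)
    moreover have "(m + \<sigma> * x) / \<sigma> = x + m / \<sigma>" using assms by (simp add: field_simps)
    ultimately show ?thesis by simp
  qed
  have "integrable lborel (\<lambda>x. ?f (m + \<sigma> * x))"
    unfolding e by (intro integrable_divide gauss_moment_integrable)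
  then show "integrable lborel ?f"
    using assms lborel_integrable_real_affine_iff[of \<sigma> ?f m] by simp
  have "(\<integral>y. ?f y \<partial>lborel) = \<bar>\<sigma>\<bar> *\<^sub>R (\<integral>x. ?f (m + \<sigma> * x) \<partial>lborel)"
    using assms by (intro lborel_integral_real_affine) simp
  also have "\<dots> = gauss_mean p (m / \<sigma>)"
    unfolding e using assms by (simp add: gauss_moment_def)
  finally show "(\<integral>y. ?f y \<partial>lborel) = gauss_mean p (m / \<sigma>)" .
qed

text \<open>Entries of Hermite tensors and products of two such entries both have this form, so a
  single mixture integral serves the means and the covariances.\<close>

definition vec_poly :: "real \<Rightarrow> ('d::finite \<Rightarrow> real poly) \<Rightarrow> real^'d \<Rightarrow> real" where
  "vec_poly \<sigma> p y = (\<Prod>c\<in>UNIV. poly (p c) (y $ c / \<sigma>))"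

lemma borel_measurable_vec_poly [measurable]: "vec_poly \<sigma> p \<in> borel_measurable borel"
proof -
  have "continuous_on UNIV (vec_poly \<sigma> p)"
    unfolding vec_poly_def divide_inverse by (intro continuous_intros)
  then show ?thesis by (rule borel_measurable_continuous_onI)
qed

lemma borel_measurable_gauss_density [measurable]: "gauss_density \<sigma> \<in> borel_measurable borel"
  unfolding gauss_density_def by measurable

lemma gauss_density_nonneg [simp]: "0 \<le> gauss_density \<sigma> y"
  by (simp add: gauss_density_def)

lemma gauss_vec_poly_integral:
  fixes w :: "real^'d"
  assumes "0 < \<sigma>"
  shows "integrable lborel (\<lambda>y. gauss_density \<sigma> (y - w) * vec_poly \<sigma> p y)"
    and "(\<integral>y. gauss_density \<sigma> (y - w) * vec_poly \<sigma> p y \<partial>lborel) = (\<Prod>c\<in>UNIV. gauss_mean (p c) (w $ c / \<sigma>))"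
proof -
  have e: "(\<lambda>y. gauss_density \<sigma> (y - w) * vec_poly \<sigma> p y) =
      (\<lambda>y. \<Prod>c\<in>UNIV. normal_density (w $ c) \<sigma> (y $ c) * poly (p c) (y $ c / \<sigma>))"
    by (simp add: fun_eq_iff gauss_density_prod[OF assms] vec_poly_def prod.distrib)
  note L = lborel_prod_vec[of "\<lambda>c x. normal_density (w $ c) \<sigma> x * poly (p c) (x / \<sigma>)", OF normal_poly_integral(1)[OF assms]]
  show "integrable lborel (\<lambda>y. gauss_density \<sigma> (y - w) * vec_poly \<sigma> p y)"
    unfolding e by (rule L(1))
  show "(\<integral>y. gauss_density \<sigma> (y - w) * vec_poly \<sigma> p y \<partial>lborel) = (\<Prod>c\<in>UNIV. gauss_mean (p c) (w $ c / \<sigma>))"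
    unfolding e by (simp only: L(2) normal_poly_integral(2)[OF assms])
qed

lemma gauss_mean_prod_bounded:
  fixes p :: "'d::finite \<Rightarrow> real poly"
  shows "\<exists>C>0. \<forall>w::real^'d. norm w \<le> R \<longrightarrow> \<bar>\<Prod>c\<in>UNIV. gauss_mean (p c) (w $ c / \<sigma>)\<bar> \<le> C"
proof -
  obtain Q where Q: "\<And>c a. gauss_mean (p c) a = poly (Q c) a"
    using choice[of "\<lambda>c Q. \<forall>a. gauss_mean (p c) a = poly Q a"] gauss_moment_poly by blast
  have "continuous_on (cball 0 R) (\<lambda>w::real^'d. \<Prod>c\<in>UNIV. gauss_mean (p c) (w $ c / \<sigma>))"
    unfolding Q divide_inverse by (intro continuous_intros)
  then have "compact ((\<lambda>w::real^'d. \<Prod>c\<in>UNIV. gauss_mean (p c) (w $ c / \<sigma>)) ` cball 0 R)"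
    by (rule compact_continuous_image) simp
  then obtain C where "C > 0" "\<forall>y\<in>(\<lambda>w::real^'d. \<Prod>c\<in>UNIV. gauss_mean (p c) (w $ c / \<sigma>)) ` cball 0 R. norm y \<le> C"
    using compact_imp_bounded bounded_pos by blast
  then show ?thesis by (intro exI[of _ C]) auto
qed

text \<open>The domination \<open>\<bar>F\<bar> \<le> 1 + F\<^sup>2\<close> keeps the Fubini argument inside polynomials.\<close>

lemma gauss_mixture_integral:
  fixes W :: "'z \<Rightarrow> real^'d"
  assumes "prob_space \<mu>" and W [measurable]: "W \<in> borel_measurable \<mu>"
    and bd: "AE z in \<mu>. norm (W z) \<le> R" and \<sigma>: "0 < \<sigma>"
  defines "D \<equiv> density lborel (\<lambda>y. ennreal (\<integral>z. gauss_density \<sigma> (y - W z) \<partial>\<mu>))"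
  shows "integrable D (vec_poly \<sigma> p)"
    and "(\<integral>y. vec_poly \<sigma> p y \<partial>D) = (\<integral>z. (\<Prod>c\<in>UNIV. gauss_mean (p c) (W z $ c / \<sigma>)) \<partial>\<mu>)"
proof -
  interpret prob_space \<mu> by fact
  interpret pair_sigma_finite \<mu> "lborel :: (real^'d) measure" ..
  let ?K = "\<lambda>z y. gauss_density \<sigma> (y - W z) * vec_poly \<sigma> p y"
  have [measurable]: "case_prod ?K \<in> borel_measurable (\<mu> \<Otimes>\<^sub>M lborel)"
    by measurable
  have [measurable]: "(\<lambda>y. \<integral>z. gauss_density \<sigma> (y - W z) \<partial>\<mu>) \<in> borel_measurable lborel"
    by measurable
  obtain C where C: "\<And>w::real^'d. norm w \<le> R \<Longrightarrow> \<bar>\<Prod>c\<in>UNIV. gauss_mean (p c * p c) (w $ c / \<sigma>)\<bar> \<le> C"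
    using gauss_mean_prod_bounded[of R "\<lambda>c. p c * p c" \<sigma>] by blast
  \<comment> \<open>In \<open>1 + C\<close>, the \<open>1\<close> is the mass of the shifted
    Gaussian and \<open>C\<close> bounds the mean of the squared polynomial.\<close>
  have nb: "(\<integral>y. norm (?K z y) \<partial>lborel) \<le> 1 + C" if z: "norm (W z) \<le> R" for z
  proof -
    let ?g = "\<lambda>y. gauss_density \<sigma> (y - W z)"
    have 1: "vec_poly \<sigma> (\<lambda>_. 1) y = 1" for y :: "real^'d" by (simp add: vec_poly_def)
    have 2: "vec_poly \<sigma> (\<lambda>c. p c * p c) y = (vec_poly \<sigma> p y)\<^sup>2" for y
      by (simp add: vec_poly_def prod.distrib power2_eq_square)
    note L1 = gauss_vec_poly_integral[OF \<sigma>, of "W z" "\<lambda>_. 1", unfolded 1]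
    note L2 = gauss_vec_poly_integral[OF \<sigma>, of "W z" "\<lambda>c. p c * p c", unfolded 2]
    have "(\<integral>y. norm (?K z y) \<partial>lborel) \<le> (\<integral>y. ?g y * 1 + ?g y * (vec_poly \<sigma> p y)\<^sup>2 \<partial>lborel)"
    proof (rule integral_mono)
      show "integrable lborel (\<lambda>y. norm (?K z y))"
        by (intro integrable_norm gauss_vec_poly_integral \<sigma>)
      show "integrable lborel (\<lambda>y. ?g y * 1 + ?g y * (vec_poly \<sigma> p y)\<^sup>2)"
        by (intro Bochner_Integration.integrable_add L1 L2)
      fix y
      have "0 \<le> (\<bar>vec_poly \<sigma> p y\<bar> - 1)\<^sup>2" by simp
      then have "\<bar>vec_poly \<sigma> p y\<bar> \<le> 1 + (vec_poly \<sigma> p y)\<^sup>2"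
        by (simp add: power2_diff)
      then have "?g y * \<bar>vec_poly \<sigma> p y\<bar> \<le> ?g y * (1 + (vec_poly \<sigma> p y)\<^sup>2)"
        by (rule mult_left_mono) simp
      then show "norm (?K z y) \<le> ?g y * 1 + ?g y * (vec_poly \<sigma> p y)\<^sup>2"
        by (simp add: abs_mult distrib_left)
    qed
    also have "\<dots> = (\<Prod>c\<in>UNIV. gauss_mean 1 (W z $ c / \<sigma>)) + (\<Prod>c\<in>UNIV. gauss_mean (p c * p c) (W z $ c / \<sigma>))"
      by (subst Bochner_Integration.integral_add) (intro L1 L2 | simp only: L1 L2)+
    also have "\<dots> \<le> 1 + C"
      using C[OF z] by (simp add: gauss_moment_def)
    finally show ?thesis .
  qed
  have int: "integrable (\<mu> \<Otimes>\<^sub>M lborel) (case_prod ?K)"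
  proof (rule Fubini_integrable)
    show "integrable \<mu> (\<lambda>z. \<integral>y. norm (case_prod ?K (z, y)) \<partial>lborel)"
    proof (rule integrable_const_bound[of _ "1 + C"])
      show "AE z in \<mu>. norm (\<integral>y. norm (case_prod ?K (z, y)) \<partial>lborel) \<le> 1 + C"
        using bd
      proof eventually_elim
        case (elim z)
        then show ?case using nb[OF elim] by (simp add: abs_of_nonneg)
      qed
    qed measurable
    show "AE z in \<mu>. integrable lborel (\<lambda>y. case_prod ?K (z, y))"
      unfolding case_prod_conv by (intro AE_I2 gauss_vec_poly_integral(1)[OF \<sigma>])
  qed measurable
  have e: "(\<integral>z. gauss_density \<sigma> (y - W z) \<partial>\<mu>) *\<^sub>R vec_poly \<sigma> p y = (\<integral>z. ?K z y \<partial>\<mu>)" for y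
    by simp
  have nn: "AE y in lborel. 0 \<le> (\<integral>z. gauss_density \<sigma> (y - W z) \<partial>\<mu>)"
    by (intro AE_I2 integral_nonneg_AE) simp
  show "integrable D (vec_poly \<sigma> p)"
    unfolding D_def using nn integrable_snd[OF int] by (subst integrable_density) (simp_all flip: e)
  have "(\<integral>y. vec_poly \<sigma> p y \<partial>D) = (\<integral>y. (\<integral>z. ?K z y \<partial>\<mu>) \<partial>lborel)"
    unfolding D_def e[symmetric] using nn by (subst integral_density) simp_all
  also have "\<dots> = (\<integral>z. (\<integral>y. ?K z y \<partial>lborel) \<partial>\<mu>)"
    by (rule Fubini_integral[OF int])
  also have "\<dots> = (\<integral>z. (\<Prod>c\<in>UNIV. gauss_mean (p c) (W z $ c / \<sigma>)) \<partial>\<mu>)"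
    by (simp only: gauss_vec_poly_integral(2)[OF \<sigma>])
  finally show "(\<integral>y. vec_poly \<sigma> p y \<partial>D) = (\<integral>z. (\<Prod>c\<in>UNIV. gauss_mean (p c) (W z $ c / \<sigma>)) \<partial>\<mu>)" .
qed

section \<open>Hermite tensors and their correlations\<close>

lemma finite_lists_length [simp]: "finite {is :: 'd::finite list. length is = k}"
  using finite_lists_length_eq[of "UNIV :: 'd set" k] by simp

lemma has_derivative_herm_exp:
  "((\<lambda>u. poly (herm n) u * exp (- u\<^sup>2 / 2)) has_real_derivative
      - (poly (herm (Suc n)) u * exp (- u\<^sup>2 / 2))) (at u)"
  by (auto intro!: derivative_eq_intros simp: algebra_simps)

lemma exp_norm_prod: "exp (- (norm x)\<^sup>2 / 2) = (\<Prod>c\<in>UNIV. exp (- (x $ c)\<^sup>2 / 2))" for x :: "real^'d"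
  by (simp add: norm_vec_squared exp_sum [symmetric] sum_negf sum_divide_distrib)

lemma frechet_derivative_coordinate_prod:
  fixes g :: "'d::finite \<Rightarrow> real \<Rightarrow> real" and x :: "real^'d"
  assumes g: "\<And>c u. (g c has_real_derivative g' c u) (at u)"
  shows "frechet_derivative (\<lambda>x. K * (\<Prod>c\<in>UNIV. g c (x $ c))) (at x) (axis i 1) =
      K * (g' i (x $ i) * (\<Prod>c\<in>UNIV - {i}. g c (x $ c)))"
proof -
  have "((\<lambda>x. g c (x $ c)) has_derivative (\<lambda>h. g' c (x $ c) * h $ c)) (at x)" for c
    using has_derivative_compose[OF bounded_linear_imp_has_derivative[OF bounded_linear_vec_nth[of c]]
        g[of c "x $ c", unfolded has_field_derivative_def]] .
  from has_derivative_mult_right[OF has_derivative_prod[where I = UNIV, OF this], of K]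
  have "frechet_derivative (\<lambda>x. K * (\<Prod>c\<in>UNIV. g c (x $ c))) (at x) =
     (\<lambda>h. K * (\<Sum>c\<in>UNIV. g' c (x $ c) * h $ c * (\<Prod>j\<in>UNIV - {c}. g j (x $ j))))"
    by (rule frechet_derivative_at [symmetric])
  moreover have "(\<Sum>c\<in>UNIV. g' c (x $ c) * axis i 1 $ c * (\<Prod>j\<in>UNIV - {c}. g j (x $ j))) =
      (\<Sum>c\<in>UNIV. if c = i then g' c (x $ c) * (\<Prod>j\<in>UNIV - {c}. g j (x $ j)) else 0)"
    by (intro sum.cong) (auto simp: axis_def)
  ultimately show ?thesis by simp
qed

text \<open>A derivative in direction \<open>i\<close> acts on the factor of coordinate
  \<open>i\<close> alone, where it raises the Hermite index by one and changes the sign. Hence only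
  the multiplicities in the list matter.\<close>

lemma iter_partial_gaussian:
  "iter_partial is (\<lambda>x::real^'d. exp (- (norm x)\<^sup>2 / 2)) =
     (\<lambda>x. (-1) ^ length is * (\<Prod>c\<in>UNIV. poly (herm (count_list is c)) (x $ c) * exp (- (x $ c)\<^sup>2 / 2)))"
proof (induction "is")
  case Nil
  show ?case by (simp add: exp_norm_prod[simplified])
next
  case (Cons i "is")
  let ?g = "\<lambda>n u. poly (herm n) u * exp (- u\<^sup>2 / 2)"
  show ?case
  proof
    fix x :: "real^'d"
    have "iter_partial (i # is) (\<lambda>x. exp (- (norm x)\<^sup>2 / 2)) x =
        (-1) ^ length is * (- ?g (Suc (count_list is i)) (x $ i) * (\<Prod>c\<in>UNIV - {i}. ?g (count_list is c) (x $ c)))"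
      unfolding iter_partial.simps Cons.IH
      by (rule frechet_derivative_coordinate_prod) (rule has_derivative_herm_exp)
    also have "(\<Prod>c\<in>UNIV - {i}. ?g (count_list is c) (x $ c)) = (\<Prod>c\<in>UNIV - {i}. ?g (count_list (i # is) c) (x $ c))"
      by (intro prod.cong) auto
    also have "(-1) ^ length is * (- ?g (Suc (count_list is i)) (x $ i) * \<dots>) =
        (-1) ^ length (i # is) * (\<Prod>c\<in>UNIV. ?g (count_list (i # is) c) (x $ c))"
      by (subst (2) prod.remove[of _ i]) (simp_all del: herm.simps)
    finally show "iter_partial (i # is) (\<lambda>x. exp (- (norm x)\<^sup>2 / 2)) x = \<dots>" .
  qed
qed

lemma hermite_eq:
  "hermite k x is = (if length is = k then \<Prod>c\<in>UNIV. poly (herm (count_list is c)) (x $ c) else 0)"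
proof -
  have "exp ((norm x)\<^sup>2 / 2) * exp (- (norm x)\<^sup>2 / 2) = 1"
    by (simp flip: exp_add)
  then have "exp ((norm x)\<^sup>2 / 2) * (\<Prod>c\<in>UNIV. exp (- (x $ c)\<^sup>2 / 2)) = 1"
    by (simp only: exp_norm_prod)
  then have "(-1) ^ k * exp ((norm x)\<^sup>2 / 2) * ((-1) ^ k * (P * (\<Prod>c\<in>UNIV. exp (- (x $ c)\<^sup>2 / 2)))) = P" for P
    by (simp add: mult.left_commute mult.assoc flip: power_mult_distrib)
  then show ?thesis
    unfolding hermite_def iter_partial_gaussian prod.distrib by (intro if_cong refl) (simp only:)
qed

definition herm_list :: "'d list \<Rightarrow> 'd \<Rightarrow> real poly" where
  "herm_list is c = herm (count_list is c)"

lemma psi_eq: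
  "psi \<sigma> y (j, b) = (\<Sum>is | length is = j. vec_poly \<sigma> (herm_list is) y * b is)"
  unfolding psi_def frob_def prod.case
  by (intro sum.cong) (auto simp: hermite_eq vec_poly_def herm_list_def divide_inverse mult.commute)

lemma prod_power_count_list:
  "(\<Prod>c\<in>UNIV. f c ^ count_list is c) = (\<Prod>i\<leftarrow>is. f i)" for f :: "'d::finite \<Rightarrow> real"
proof (induction "is")
  case (Cons i "is")
  have "(\<Prod>c\<in>UNIV. f c ^ count_list (i # is) c) = (\<Prod>c\<in>UNIV. (if c = i then f c else 1) * f c ^ count_list is c)"
    by (intro prod.cong) auto
  then show ?case using Cons by (simp add: prod.distrib)
qed simp

text \<open>The correlation of the entries \<open>is\<close> and \<open>js\<close> of two Hermite
  tensors under the Gaussian with mean \<open>w\<close> and unit covariance; it factors because the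
  coordinates are independent.\<close>

definition corr_lists :: "'d::finite list \<Rightarrow> 'd list \<Rightarrow> real^'d \<Rightarrow> real" where
  "corr_lists is js w = (\<Prod>c\<in>UNIV. herm_corr (count_list is c) (count_list js c) (w $ c))"

text \<open>The value of \<open>corr_lists\<close> at mean \<open>0\<close>, by orthogonality of the
  Hermite polynomials.\<close>

definition corr_lists_0 :: "'d::finite list \<Rightarrow> 'd list \<Rightarrow> real" where
  "corr_lists_0 is js = (if mset is = mset js then \<Prod>c\<in>UNIV. fact (count_list is c) else 0)"

lemma corr_lists_eq:
  "corr_lists is js w = (\<Prod>c\<in>UNIV. gauss_mean (herm_list is c * herm_list js c) (w $ c))"
  by (simp add: corr_lists_def herm_corr_def herm_list_def)

lemma mset_eq_iff_count_list: "mset is = mset js \<longleftrightarrow> count_list is = count_list js"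
  by (simp add: multiset_eq_iff fun_eq_iff count_mset)

text \<open>\<open>N\<close> is the total exponent of \<open>t\<close> in the correlation; it has the parity of the difference of
  the orders and is at least its absolute value.\<close>

lemma count_list_diff_sum:
  fixes "is" js :: "'d::finite list"
  defines "N \<equiv> \<Sum>c\<in>UNIV. nat \<bar>int (count_list is c) - int (count_list js c)\<bar>"
  assumes "mset is \<noteq> mset js"
  shows "1 \<le> N" and "\<bar>int (length is) - int (length js)\<bar> \<noteq> 1 \<Longrightarrow> 2 \<le> N"
proof -
  let ?x = "\<lambda>c. int (count_list is c) - int (count_list js c)"
  have "N \<noteq> 0" using assms(2) by (auto simp: N_def mset_eq_iff_count_list)
  then show "1 \<le> N" by simp
  have s: "(\<Sum>c\<in>UNIV. ?x c) = int (length is) - int (length js)"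
    by (simp add: sum_subtractf sum_count_set flip: of_nat_sum)
  have iN: "int N = (\<Sum>c\<in>UNIV. \<bar>?x c\<bar>)" by (simp add: N_def)
  have "\<bar>int (length is) - int (length js)\<bar> \<le> int N"
    unfolding iN s[symmetric] by (rule sum_abs)
  moreover have "even (int N - (int (length is) - int (length js)))"
    unfolding iN s[symmetric] sum_subtractf[symmetric] by (rule dvd_sum) (auto simp: abs_if)
  ultimately show "2 \<le> N" if "\<bar>int (length is) - int (length js)\<bar> \<noteq> 1"
    using that \<open>1 \<le> N\<close> by presburger
qed

text \<open>Telescoping, one coordinate at a time: replace the new factor by its limit, then the
  product of the others. The restriction \<open>t \<le> 1\<close> keeps \<open>t * a c\<close> in
  the range of \<open>herm_corr_diag_bound\<close> and the partial products bounded.\<close>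

lemma herm_corr_diag_prod_bound:
  fixes n :: "'d \<Rightarrow> nat"
  assumes "finite S"
  shows "\<exists>C\<ge>0. \<forall>t a. 0 \<le> t \<longrightarrow> t \<le> 1 \<longrightarrow> (\<forall>c. \<bar>a c\<bar> \<le> R) \<longrightarrow>
      \<bar>(\<Prod>c\<in>S. herm_corr (n c) (n c) (t * a c)) - (\<Prod>c\<in>S. fact (n c))\<bar> \<le> C * t\<^sup>2"
  using assms
proof (induction S)
  case empty
  show ?case by (intro exI[of _ 0]) simp
next
  case (insert s S)
  then obtain C where C: "C \<ge> 0" "\<And>t a. \<lbrakk>0 \<le> t; t \<le> 1; \<forall>c. \<bar>a c\<bar> \<le> R\<rbrakk> \<Longrightarrow>
      \<bar>(\<Prod>c\<in>S. herm_corr (n c) (n c) (t * a c)) - (\<Prod>c\<in>S. fact (n c))\<bar> \<le> C * t\<^sup>2"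
    by blast
  obtain D where D: "D > 0" "\<And>a. \<bar>a\<bar> \<le> R \<Longrightarrow> \<bar>herm_corr (n s) (n s) a - fact (n s)\<bar> \<le> D * a\<^sup>2"
    using herm_corr_diag_bound by metis
  let ?G = "\<Prod>c\<in>S. fact (n c) :: real"
  have G: "0 \<le> ?G" by (intro prod_nonneg) simp
  \<comment> \<open>\<open>D * R\<^sup>2\<close> bounds the error of the new factor,
    \<open>?G + C\<close> the product of the remaining ones, and \<open>fact (n s) * C\<close> is
    the old error times the limit of the new factor.\<close>
  show ?case
  proof (intro exI[of _ "(D * R\<^sup>2) * (?G + C) + fact (n s) * C"] conjI allI impI)
    show "0 \<le> (D * R\<^sup>2) * (?G + C) + fact (n s) * C" using C(1) D(1) G by simp
    fix t :: real and a :: "'d \<Rightarrow> real" assume t: "0 \<le> t" "t \<le> 1" and a: "\<forall>c. \<bar>a c\<bar> \<le> R"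
    let ?f = "herm_corr (n s) (n s) (t * a s)" and ?F = "\<Prod>c\<in>S. herm_corr (n c) (n c) (t * a c)"
    have "\<bar>a s\<bar> \<le> R" using a by blast
    then have "\<bar>t * a s\<bar> \<le> R" and "(a s)\<^sup>2 \<le> R\<^sup>2"
      using t mult_mono[of "\<bar>t\<bar>" 1 "\<bar>a s\<bar>" R] by (auto simp: abs_mult simp flip: abs_le_square_iff)
    from D(2)[OF this(1)] have "\<bar>?f - fact (n s)\<bar> \<le> D * R\<^sup>2 * t\<^sup>2"
      by (rule order_trans) (use D(1) \<open>(a s)\<^sup>2 \<le> R\<^sup>2\<close> in
          \<open>simp add: power_mult_distrib mult.assoc mult.commute[of "t\<^sup>2"] mult_right_mono\<close>)
    moreover have FG: "\<bar>?F - ?G\<bar> \<le> C * t\<^sup>2" using C(2) t a by blast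
    moreover have "\<bar>?F\<bar> \<le> ?G + C"
    proof -
      have "C * t\<^sup>2 \<le> C" using C(1) t by (simp add: mult_left_le power_le_one)
      then show ?thesis using FG G by linarith
    qed
    moreover have "?f * ?F - fact (n s) * ?G = (?f - fact (n s)) * ?F + fact (n s) * (?F - ?G)"
      by (simp add: algebra_simps)
    ultimately have "\<bar>?f * ?F - fact (n s) * ?G\<bar> \<le> (D * R\<^sup>2 * t\<^sup>2) * (?G + C) + fact (n s) * (C * t\<^sup>2)"
      using D(1) by (auto simp: abs_mult intro!: order_trans[OF abs_triangle_ineq] add_mono mult_mono)
    then show "\<bar>(\<Prod>c\<in>insert s S. herm_corr (n c) (n c) (t * a c)) - (\<Prod>c\<in>insert s S. fact (n c))\<bar>
        \<le> ((D * R\<^sup>2) * (?G + C) + fact (n s) * C) * t\<^sup>2"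
      using insert.hyps by (simp add: algebra_simps)
  qed
qed

text \<open>A lower bound for the order in \<open>t\<close> of the error in block
  \<open>(i, j)\<close>, with diagonal blocks under the value \<open>2\<close>. It is capped at
  \<open>2\<close> because inversion mixes in products of two errors, which are only known to be of
  second order.\<close>

definition off_order :: "nat \<Rightarrow> nat \<Rightarrow> nat" where
  "off_order i j = (if \<bar>int i - int j\<bar> = 1 then 1 else 2)"

text \<open>If the multisets agree, all factors are diagonal and the error is quadratic. Otherwise
  the limit is \<open>0\<close>, each coordinate contributes \<open>t ^ ?d c\<close>, and the
  exponents add up to the \<open>N\<close> of \<open>count_list_diff_sum\<close>.\<close>

lemma corr_lists_bound:
  fixes "is" js :: "'d::finite list"
  shows "\<exists>C\<ge>0. \<forall>t (w::real^'d). 0 \<le> t \<longrightarrow> t \<le> 1 \<longrightarrow> norm w \<le> R \<longrightarrow>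
      \<bar>corr_lists is js (t *\<^sub>R w) - corr_lists_0 is js\<bar> \<le> C * t ^ off_order (length is) (length js)"
proof (cases "mset is = mset js")
  case True
  then have e: "count_list js = count_list is" and l: "length js = length is"
    by (simp add: mset_eq_iff_count_list) (metis True mset_eq_length)
  obtain C where C: "C \<ge> 0" "\<And>t a. \<lbrakk>0 \<le> t; t \<le> 1; \<forall>c::'d. \<bar>a c\<bar> \<le> R\<rbrakk> \<Longrightarrow>
      \<bar>(\<Prod>c\<in>UNIV. herm_corr (count_list is c) (count_list is c) (t * a c)) - (\<Prod>c\<in>UNIV. fact (count_list is c))\<bar> \<le> C * t\<^sup>2"
    using herm_corr_diag_prod_bound[OF finite, of R "count_list is"] by blast
  have "\<bar>corr_lists is js (t *\<^sub>R w) - corr_lists_0 is js\<bar> \<le> C * t ^ off_order (length is) (length js)"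
    if "0 \<le> t" "t \<le> 1" "norm w \<le> R" for t and w :: "real^'d"
  proof -
    have "\<forall>c. \<bar>w $ c\<bar> \<le> R" using that(3) component_le_norm_cart order_trans by blast
    from C(2)[OF that(1,2) this] show ?thesis
      using True by (simp add: corr_lists_def corr_lists_0_def e l off_order_def)
  qed
  then show ?thesis using C(1) by blast
next
  case False
  let ?d = "\<lambda>c. nat \<bar>int (count_list is c) - int (count_list js c)\<bar>"
  have "\<forall>c. \<exists>C>0. \<forall>a. \<bar>a\<bar> \<le> R \<longrightarrow> \<bar>herm_corr (count_list is c) (count_list js c) a\<bar> \<le> C * \<bar>a\<bar> ^ ?d c"
    using herm_corr_bound by blast
  then obtain C where C: "\<And>c. C c > 0" "\<And>c a. \<bar>a\<bar> \<le> R \<Longrightarrow>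
      \<bar>herm_corr (count_list is c) (count_list js c) a\<bar> \<le> C c * \<bar>a\<bar> ^ ?d c"
    by metis
  have le: "off_order (length is) (length js) \<le> (\<Sum>c\<in>UNIV. ?d c)"
    using count_list_diff_sum[OF False] by (auto simp: off_order_def)
  \<comment> \<open>The sign of \<open>R\<close> is not known; its absolute value makes the constant
    nonnegative in any case.\<close>
  let ?C = "\<Prod>c\<in>UNIV. C c * \<bar>R\<bar> ^ ?d c"
  have C0: "0 \<le> ?C" using C(1) by (intro prod_nonneg) (simp add: less_imp_le)
  have "\<bar>corr_lists is js (t *\<^sub>R w) - corr_lists_0 is js\<bar> \<le> ?C * t ^ off_order (length is) (length js)"
    if t: "0 \<le> t" "t \<le> 1" and w: "norm w \<le> R" for t and w :: "real^'d"
  proof -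
    have wc: "\<bar>w $ c\<bar> \<le> R" for c using w component_le_norm_cart order_trans by blast
    have "\<bar>corr_lists is js (t *\<^sub>R w)\<bar> = (\<Prod>c\<in>UNIV. \<bar>herm_corr (count_list is c) (count_list js c) (t * w $ c)\<bar>)"
      by (simp add: corr_lists_def abs_prod)
    also have "\<dots> \<le> (\<Prod>c\<in>UNIV. (C c * \<bar>R\<bar> ^ ?d c) * t ^ ?d c)"
    proof (intro prod_mono conjI abs_ge_zero)
      fix c
      have "\<bar>t * w $ c\<bar> \<le> R" using t wc[of c] mult_mono[of "\<bar>t\<bar>" 1 "\<bar>w $ c\<bar>" R] by (simp add: abs_mult)
      then have "\<bar>herm_corr (count_list is c) (count_list js c) (t * w $ c)\<bar> \<le> C c * \<bar>t * w $ c\<bar> ^ ?d c" by (rule C(2))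
      also have "\<dots> \<le> C c * (\<bar>R\<bar> * t) ^ ?d c"
        using C(1)[of c] t wc[of c]
        by (intro mult_left_mono power_mono) (auto simp: abs_mult mult.commute[of t] intro!: mult_right_mono)
      finally show "\<bar>herm_corr (count_list is c) (count_list js c) (t * w $ c)\<bar> \<le> C c * \<bar>R\<bar> ^ ?d c * t ^ ?d c"
        by (simp add: power_mult_distrib mult.assoc)
    qed
    also have "\<dots> = ?C * t ^ (\<Sum>c\<in>UNIV. ?d c)" by (simp add: prod.distrib power_sum)
    also have "\<dots> \<le> ?C * t ^ off_order (length is) (length js)"
      using C0 t le by (intro mult_left_mono power_decreasing)
    finally show ?thesis using False by (simp add: corr_lists_0_def)
  qed
  then show ?thesis using C0 by blast
qed

text \<open>The origin of \<open>j!\<close> in the covariance: only rearrangements of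
  \<open>is\<close> survive, a symmetric tensor is constant on them, and their number times the
  product of the factorials of the multiplicities is \<open>k!\<close>.\<close>

lemma corr_lists_0_sym_sum:
  assumes b: "b \<in> sym_tensors j" and "is": "length is = k"
  shows "(\<Sum>js | length js = j. b js * corr_lists_0 is js) = fact k * b is"
proof (cases "j = k")
  case False
  then have "corr_lists_0 is js = 0" if "length js = j" for js
    using that "is" by (auto simp: corr_lists_0_def dest: mset_eq_length)
  moreover have "b is = 0" using b "is" False by (auto simp: sym_tensors_def)
  ultimately show ?thesis by simp
next
  case True
  let ?P = "\<Prod>c\<in>UNIV. fact (count_list is c) :: nat"
  have P: "{js. mset js = mset is} = permutations_of_multiset (mset is)"
    by (auto simp: permutations_of_multiset_def)
  \<comment> \<open>Coordinates that do not occur contribute \<open>0! = 1\<close>.\<close>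
  have "?P = (\<Prod>c\<in>set_mset (mset is). fact (count (mset is) c))"
    by (intro prod.mono_neutral_cong_right) (auto simp: count_mset count_list_0_iff)
  then have card: "card {js. mset js = mset is} * ?P = fact k"
    using card_permutations_of_multiset_aux[of "mset is"] "is" P by simp
  have "(\<Sum>js | length js = j. b js * corr_lists_0 is js) = (\<Sum>js | mset js = mset is. b js * corr_lists_0 is js)"
    by (intro sum.mono_neutral_right) (use "is" True in \<open>auto simp: corr_lists_0_def dest: mset_eq_length\<close>)
  also have "\<dots> = (\<Sum>js | mset js = mset is. b is * real ?P)"
  proof (intro sum.cong refl)
    fix js assume "js \<in> {js. mset js = mset is}"
    then have m: "mset js = mset is" by simp
    then have "b js = b is" using b unfolding sym_tensors_def by blast
    then show "b js * corr_lists_0 is js = b is * real ?P"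
      unfolding corr_lists_0_def m by simp
  qed
  also have "\<dots> = b is * real (card {js. mset js = mset is} * ?P)"
    by simp
  also have "\<dots> = fact k * b is" unfolding card by simp
  finally show ?thesis .
qed

section \<open>Moments of the features\<close>

lemma power_bigo_at_right_0:
  assumes "b \<le> a"
  shows "(\<lambda>x::real. x ^ a) \<in> O[at_right 0](\<lambda>x. x ^ b)"
proof (rule bigoI[of _ 1])
  show "\<forall>\<^sub>F x in at_right (0::real). norm (x ^ a) \<le> 1 * norm (x ^ b)"
    using eventually_at_right_less[of 0] eventually_at_right_field[of "\<lambda>x. x < 1" 0]
    by (auto simp: eventually_at_right_field power_abs intro!: exI[of _ 1] power_decreasing assms)
qed

text \<open>For odd \<open>e\<close> the exponent is a half-integer, hence \<open>powr\<close>;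
  approaching \<open>0\<close> from the right supplies the positive base that it requires.\<close>

lemma power_snr_bigo:
  assumes "0 < \<sigma>" and f: "f \<in> O[at_right 0](\<lambda>\<beta>. \<beta> ^ e)"
  shows "f \<in> O[at_right 0](\<lambda>\<beta>. snr \<sigma> \<beta> powr (real e / 2))"
proof -
  have "(\<lambda>\<beta>. \<beta> ^ e) \<in> O[at_right 0](\<lambda>\<beta>. snr \<sigma> \<beta> powr (real e / 2))"
  proof (rule bigoI)
    show "\<forall>\<^sub>F \<beta> in at_right 0. norm (\<beta> ^ e) \<le> \<sigma> ^ e * norm (snr \<sigma> \<beta> powr (real e / 2))"
      using eventually_at_right_less[of 0]
    proof eventually_elim
      case (elim \<beta>)
      have "snr \<sigma> \<beta> = (\<beta> / \<sigma>) powr 2" using elim assms(1) by (simp add: snr_def power_divide)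
      then have "snr \<sigma> \<beta> powr (real e / 2) = (\<beta> / \<sigma>) powr (2 * (real e / 2))"
        by (simp only: powr_powr)
      also have "\<dots> = (\<beta> / \<sigma>) ^ e"
        using elim assms(1) by (simp add: powr_realpow)
      finally have "snr \<sigma> \<beta> powr (real e / 2) = (\<beta> / \<sigma>) ^ e" .
      then show ?case using elim assms(1) by (simp add: power_divide)
    qed
  qed
  with f show ?thesis by (rule landau_o.big_trans)
qed

lemma power_snr_bigo_even:
  assumes "0 < \<sigma>" and f: "f \<in> O[at_right 0](\<lambda>\<beta>. \<beta> ^ (2 * n))"
  shows "f \<in> O[at_right 0](\<lambda>\<beta>. snr \<sigma> \<beta> ^ n)"
proof -
  have "(\<lambda>\<beta>. \<beta> ^ (2 * n)) \<in> O[at_right 0](\<lambda>\<beta>. snr \<sigma> \<beta> ^ n)"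
    using assms(1) by (intro bigoI[of _ "\<sigma> ^ (2 * n)"]) (simp add: snr_def power_divide power_mult)
  with f show ?thesis by (rule landau_o.big_trans)
qed

lemma cmult_bigo: "f \<in> O[F](g) \<Longrightarrow> (\<lambda>x. c * f x :: real) \<in> O[F](g)"
  by (cases "c = 0") auto

section \<open>Means and covariances of the features in the observation model\<close>

locale linear_mixture = prob_space \<mu> for \<mu> :: "'z measure" +
  fixes A :: "'z \<Rightarrow> real^'m^'d" and \<sigma> amax :: real
  assumes A_measurable [measurable]: "A \<in> borel_measurable \<mu>"
    and \<sigma>_pos: "0 < \<sigma>"
    and A_bounded: "AE z in \<mu>. onorm ((*v) (A z)) \<le> amax"
begin

lemma A_mult_measurable [measurable]: "(\<lambda>z. A z *v \<theta>) \<in> borel_measurable \<mu>"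
proof (rule measurable_compose[OF A_measurable])
  have "continuous_on UNIV (\<lambda>M::real^'m^'d. M *v \<theta>)"
    unfolding matrix_vector_mult_def by (intro continuous_intros)
  then show "(\<lambda>M::real^'m^'d. M *v \<theta>) \<in> borel_measurable borel"
    by (rule borel_measurable_continuous_onI)
qed

text \<open>Confines the means of the mixture components to a fixed ball; the uniform error bounds
  are applied there.\<close>

lemma A_mult_bounded: "AE z in \<mu>. norm (A z *v \<theta>) \<le> amax * norm \<theta>"
  using A_bounded
proof eventually_elim
  case (elim z)
  have "norm (A z *v \<theta>) \<le> onorm ((*v) (A z)) * norm \<theta>"
    by (rule onorm) simp
  also have "\<dots> \<le> amax * norm \<theta>" using elim by (rule mult_right_mono) simp
  finally show ?case .
qed

lemma obs_vec_poly:
  shows "integrable (obs_law \<mu> A \<sigma> \<theta> \<beta>) (vec_poly \<sigma> p)"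
    and "(\<integral>y. vec_poly \<sigma> p y \<partial>obs_law \<mu> A \<sigma> \<theta> \<beta>) =
      (\<integral>z. (\<Prod>c\<in>UNIV. gauss_mean (p c) (((\<beta> / \<sigma>) *\<^sub>R (A z *v \<theta>)) $ c)) \<partial>\<mu>)"
proof -
  have m: "(\<lambda>z. \<beta> *\<^sub>R (A z *v \<theta>)) \<in> borel_measurable \<mu>" by measurable
  have b: "AE z in \<mu>. norm (\<beta> *\<^sub>R (A z *v \<theta>)) \<le> \<bar>\<beta>\<bar> * (amax * norm \<theta>)"
    using A_mult_bounded[of \<theta>] by eventually_elim (simp add: mult_left_mono)
  note G = gauss_mixture_integral[OF prob_space_axioms m b \<sigma>_pos, of p, folded obs_density_def, folded obs_law_def]
  show "integrable (obs_law \<mu> A \<sigma> \<theta> \<beta>) (vec_poly \<sigma> p)" by (rule G(1))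
  show "(\<integral>y. vec_poly \<sigma> p y \<partial>obs_law \<mu> A \<sigma> \<theta> \<beta>) =
      (\<integral>z. (\<Prod>c\<in>UNIV. gauss_mean (p c) (((\<beta> / \<sigma>) *\<^sub>R (A z *v \<theta>)) $ c)) \<partial>\<mu>)"
    using G(2) by simp
qed

text \<open>\<open>obs_law\<close> is given by a density, so its mass has to be computed; it is the
  mean of the constant polynomial \<open>1\<close>.\<close>

lemma obs_total: "(\<integral>y. 1 \<partial>obs_law \<mu> A \<sigma> \<theta> \<beta>) = (1::real)" "integrable (obs_law \<mu> A \<sigma> \<theta> \<beta>) (\<lambda>_. 1 :: real)"
proof -
  have 1: "vec_poly \<sigma> (\<lambda>_. 1) = (\<lambda>_::real^'d. 1)" by (simp add: vec_poly_def fun_eq_iff)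
  show "(\<integral>y. 1 \<partial>obs_law \<mu> A \<sigma> \<theta> \<beta>) = (1::real)" "integrable (obs_law \<mu> A \<sigma> \<theta> \<beta>) (\<lambda>_. 1 :: real)"
    using obs_vec_poly[of \<theta> \<beta> "\<lambda>_. 1"] by (simp_all add: 1 gauss_moment_def prob_space)
qed

lemma integrable_psi: "integrable (obs_law \<mu> A \<sigma> \<theta> \<beta>) (\<lambda>y. psi \<sigma> y (j, b))"
  unfolding psi_eq by (intro Bochner_Integration.integrable_sum integrable_mult_left obs_vec_poly)

text \<open>Hermite polynomials undo the Gaussian smoothing: by \<open>gauss_mean_herm\<close> the
  mean of \<open>herm n\<close> at shift \<open>a\<close> is exactly \<open>a ^ n\<close>, so the
  noise leaves no lower-order terms.\<close>

lemma mean_M_eq: "mean_M \<mu> A \<sigma> \<theta> \<beta> (j, b) = (\<beta> / \<sigma>) ^ j * frob j (moment_T \<mu> A j \<theta>) b"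
proof -
  have e: "(\<Prod>c\<in>UNIV. gauss_mean (herm_list is c) ((t *\<^sub>R (w::real^'d)) $ c)) = t ^ j * tensor_power j w is"
    if "length is = j" for "is" and t w
    using that prod_power_count_list[of "\<lambda>c. t * w $ c" "is"] prod_power_count_list[of "\<lambda>c. w $ c" "is"]
      prod_power_count_list[of "\<lambda>c. t" "is"]
    by (simp add: herm_list_def gauss_mean_herm tensor_power_def power_mult_distrib prod.distrib prod_list_replicate map_replicate_const)
  have "mean_M \<mu> A \<sigma> \<theta> \<beta> (j, b) = (\<Sum>is | length is = j. (\<integral>y. vec_poly \<sigma> (herm_list is) y \<partial>obs_law \<mu> A \<sigma> \<theta> \<beta>) * b is)"
    unfolding mean_M_def psi_eq
    by (subst Bochner_Integration.integral_sum) (auto intro: obs_vec_poly)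
  also have "\<dots> = (\<Sum>is | length is = j. (\<beta> / \<sigma>) ^ j * moment_T \<mu> A j \<theta> is * b is)"
    by (intro sum.cong refl) (simp add: obs_vec_poly(2) e moment_T_def del: vector_scaleR_component)
  finally show ?thesis by (simp add: frob_def sum_distrib_left mult.assoc)
qed

lemma psi_product_moment:
  shows "integrable (obs_law \<mu> A \<sigma> \<theta> \<beta>) (\<lambda>y. psi \<sigma> y (j, b) * psi \<sigma> y (j', b'))"
    and "(\<integral>y. psi \<sigma> y (j, b) * psi \<sigma> y (j', b') \<partial>obs_law \<mu> A \<sigma> \<theta> \<beta>) =
      (\<Sum>is | length is = j. \<Sum>js | length js = j'.
        (b is * b' js) * (\<integral>z. corr_lists is js ((\<beta> / \<sigma>) *\<^sub>R (A z *v \<theta>)) \<partial>\<mu>))"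
proof -
  have e: "psi \<sigma> y (j, b) * psi \<sigma> y (j', b') =
      (\<Sum>is | length is = j. \<Sum>js | length js = j'.
        (b is * b' js) * vec_poly \<sigma> (\<lambda>c. herm_list is c * herm_list js c) y)" for y :: "real^'d"
    unfolding psi_eq sum_product by (intro sum.cong refl) (simp add: vec_poly_def prod.distrib)
  show "integrable (obs_law \<mu> A \<sigma> \<theta> \<beta>) (\<lambda>y. psi \<sigma> y (j, b) * psi \<sigma> y (j', b'))"
    unfolding e by (intro Bochner_Integration.integrable_sum integrable_mult_right obs_vec_poly)
  show "(\<integral>y. psi \<sigma> y (j, b) * psi \<sigma> y (j', b') \<partial>obs_law \<mu> A \<sigma> \<theta> \<beta>) =
      (\<Sum>is | length is = j. \<Sum>js | length js = j'.
        (b is * b' js) * (\<integral>z. corr_lists is js ((\<beta> / \<sigma>) *\<^sub>R (A z *v \<theta>)) \<partial>\<mu>))"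
    unfolding e corr_lists_eq obs_vec_poly(2)[symmetric]
    by (subst Bochner_Integration.integral_sum,
        intro Bochner_Integration.integrable_sum integrable_mult_right obs_vec_poly,
        intro sum.cong refl, subst Bochner_Integration.integral_sum,
        intro integrable_mult_right obs_vec_poly, simp)
qed

lemma cov_Sigma_eq:
  "cov_Sigma \<mu> A \<sigma> \<theta> \<beta> (j, b) (j', b') =
     (\<integral>y. psi \<sigma> y (j, b) * psi \<sigma> y (j', b') \<partial>obs_law \<mu> A \<sigma> \<theta> \<beta>)
      - mean_M \<mu> A \<sigma> \<theta> \<beta> (j, b) * mean_M \<mu> A \<sigma> \<theta> \<beta> (j', b')"
proof -
  let ?O = "obs_law \<mu> A \<sigma> \<theta> \<beta>" let ?m = "mean_M \<mu> A \<sigma> \<theta> \<beta> (j, b)" and ?m' = "mean_M \<mu> A \<sigma> \<theta> \<beta> (j', b')"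
  have "cov_Sigma \<mu> A \<sigma> \<theta> \<beta> (j, b) (j', b') =
    (\<integral>y. ((psi \<sigma> y (j, b) * psi \<sigma> y (j', b') - ?m' * psi \<sigma> y (j, b)) - ?m * psi \<sigma> y (j', b')) + ?m * ?m' * 1 \<partial>?O)"
    unfolding cov_Sigma_def by (intro Bochner_Integration.integral_cong) (auto simp: algebra_simps)
  also have "\<dots> = (((\<integral>y. psi \<sigma> y (j, b) * psi \<sigma> y (j', b') \<partial>?O) - (\<integral>y. ?m' * psi \<sigma> y (j, b) \<partial>?O))
       - (\<integral>y. ?m * psi \<sigma> y (j', b') \<partial>?O)) + (\<integral>y. ?m * ?m' * 1 \<partial>?O)"
    by (subst Bochner_Integration.integral_add Bochner_Integration.integral_diff,
      (intro Bochner_Integration.integrable_diff integrable_mult_right psi_product_moment integrable_psi obs_total)+)+ simp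
  also have "\<dots> = (\<integral>y. psi \<sigma> y (j, b) * psi \<sigma> y (j', b') \<partial>?O) - ?m * ?m'"
    unfolding integral_mult_right_zero obs_total by (simp add: mean_M_def algebra_simps)
  finally show ?thesis .
qed

lemma corr_lists_measurable [measurable]: "corr_lists is js \<in> borel_measurable borel"
proof -
  have "\<forall>c. \<exists>Q. \<forall>a. gauss_mean (herm_list is c * herm_list js c) a = poly Q a"
    using gauss_moment_poly by blast
  then obtain Q where Q: "\<And>c a. gauss_mean (herm_list is c * herm_list js c) a = poly (Q c) a"
    by metis
  have "continuous_on UNIV (corr_lists is js)"
    unfolding corr_lists_eq Q by (intro continuous_intros)
  then show ?thesis by (rule borel_measurable_continuous_onI)
qed

lemma corr_lists_mean_bigo:
  "(\<lambda>\<beta>. (\<integral>z. corr_lists is js ((\<beta> / \<sigma>) *\<^sub>R (A z *v \<theta>)) \<partial>\<mu>) - corr_lists_0 is js)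
     \<in> O[at_right 0](\<lambda>\<beta>. \<beta> ^ off_order (length is) (length js))"
proof -
  let ?e = "off_order (length is) (length js)"
  obtain C where C: "C \<ge> 0" "\<And>t (w::real^'d). \<lbrakk>0 \<le> t; t \<le> 1; norm w \<le> amax * norm \<theta>\<rbrakk> \<Longrightarrow>
      \<bar>corr_lists is js (t *\<^sub>R w) - corr_lists_0 is js\<bar> \<le> C * t ^ ?e"
    using corr_lists_bound by blast
  have "\<bar>(\<integral>z. corr_lists is js ((\<beta> / \<sigma>) *\<^sub>R (A z *v \<theta>)) \<partial>\<mu>) - corr_lists_0 is js\<bar> \<le> C * (\<beta> / \<sigma>) ^ ?e"
    if \<beta>: "0 < \<beta>" "\<beta> < \<sigma>" for \<beta>
  proof -
    let ?f = "\<lambda>z. corr_lists is js ((\<beta> / \<sigma>) *\<^sub>R (A z *v \<theta>)) - corr_lists_0 is js"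
    \<comment> \<open>The range of \<open>t\<close> in which \<open>corr_lists_bound\<close>
      applies.\<close>
    have t: "0 \<le> \<beta> / \<sigma>" "\<beta> / \<sigma> \<le> 1" using \<beta> \<sigma>_pos by auto
    have bd: "AE z in \<mu>. norm (?f z) \<le> C * (\<beta> / \<sigma>) ^ ?e"
      using A_mult_bounded[of \<theta>] by eventually_elim (use C(2)[OF t] in simp)
    have int: "integrable \<mu> ?f"
      by (rule integrable_const_bound[OF bd]) measurable
    have "(\<integral>z. corr_lists is js ((\<beta> / \<sigma>) *\<^sub>R (A z *v \<theta>)) \<partial>\<mu>) = (\<integral>z. ?f z + corr_lists_0 is js \<partial>\<mu>)"
      by simp
    also have "\<dots> = (\<integral>z. ?f z \<partial>\<mu>) + corr_lists_0 is js"
      using int by (subst Bochner_Integration.integral_add) (simp_all add: prob_space)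
    finally have "(\<integral>z. corr_lists is js ((\<beta> / \<sigma>) *\<^sub>R (A z *v \<theta>)) \<partial>\<mu>) - corr_lists_0 is js = (\<integral>z. ?f z \<partial>\<mu>)"
      by simp
    moreover have "\<bar>\<integral>z. ?f z \<partial>\<mu>\<bar> \<le> (\<integral>z. norm (?f z) \<partial>\<mu>)"
      using integral_norm_bound[of \<mu> ?f] by simp
    moreover have "(\<integral>z. norm (?f z) \<partial>\<mu>) \<le> (\<integral>z. C * (\<beta> / \<sigma>) ^ ?e \<partial>\<mu>)"
      by (intro integral_mono_AE) (use int bd in auto)
    moreover have "(\<integral>z. C * (\<beta> / \<sigma>) ^ ?e \<partial>\<mu>) = C * (\<beta> / \<sigma>) ^ ?e"
      by (simp add: prob_space)
    ultimately show ?thesis by linarith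
  qed
  then show ?thesis
    using \<sigma>_pos
    by (intro bigoI[of _ "C / \<sigma> ^ ?e"])
      (auto simp: eventually_at_right_field power_divide intro!: exI[of _ \<sigma>])
qed

lemma cov_Sigma_bigo:
  assumes B: "\<And>j. sym_orthonormal_basis j (B j)"
    and i: "i \<in> feats L B" and i': "i' \<in> feats L B"
  shows "(\<lambda>\<beta>. cov_Sigma \<mu> A \<sigma> \<theta> \<beta> i i' - (if i = i' then fact (fst i) else 0))
      \<in> O[at_right 0](\<lambda>\<beta>. \<beta> ^ off_order (fst i) (fst i'))"
proof -
  obtain j b j' b' where e: "i = (j, b)" "i' = (j', b')" by (cases i, cases i')
  have j: "1 \<le> j" "b \<in> B j" "1 \<le> j'" "b' \<in> B j'" using i i' by (auto simp: feats_def e)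
  have b': "b' \<in> sym_tensors j'" using B[of j'] j by (auto simp: sym_orthonormal_basis_def)
  \<comment> \<open>The limit of the second moments: summing over \<open>js\<close> first gives a
    multiple of \<open>b'\<close>, and orthonormality of the basis makes the rest diagonal.\<close>
  have "(\<Sum>is | length is = j. \<Sum>js | length js = j'. (b is * b' js) * corr_lists_0 is js) =
      (\<Sum>is | length is = j. b is * (\<Sum>js | length js = j'. b' js * corr_lists_0 is js))"
    by (simp add: sum_distrib_left mult.assoc)
  also have "\<dots> = (\<Sum>is | length is = j. b is * (fact j * b' is))"
    by (intro sum.cong refl) (simp add: corr_lists_0_sym_sum[OF b'])
  also have "\<dots> = fact j * frob j b b'"
    by (simp add: frob_def sum_distrib_left mult.left_commute)
  also have "\<dots> = (if i = i' then fact j else 0)"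
  proof (cases "j = j'")
    case True
    then show ?thesis using B[of j] j by (auto simp: sym_orthonormal_basis_def e)
  next
    case False
    then have "b' is = 0" if "length is = j" for "is" using b' that by (auto simp: sym_tensors_def)
    then show ?thesis using False by (simp add: frob_def e)
  qed
  finally have d: "(\<Sum>is | length is = j. \<Sum>js | length js = j'. (b is * b' js) * corr_lists_0 is js) =
      (if i = i' then fact j else 0)" .
  let ?c = "\<lambda>is js \<beta>. (\<integral>z. corr_lists is js ((\<beta> / \<sigma>) *\<^sub>R (A z *v \<theta>)) \<partial>\<mu>) - corr_lists_0 is js"
  let ?q = "frob j (moment_T \<mu> A j \<theta>) b * frob j' (moment_T \<mu> A j' \<theta>) b' / \<sigma> ^ (j + j')"
  have "cov_Sigma \<mu> A \<sigma> \<theta> \<beta> i i' - (if i = i' then fact j else 0) =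
      (\<Sum>is | length is = j. \<Sum>js | length js = j'. (b is * b' js) * ?c is js \<beta>) - ?q * \<beta> ^ (j + j')" for \<beta>
    unfolding d[symmetric] unfolding e cov_Sigma_eq psi_product_moment mean_M_eq
    by (simp add: right_diff_distrib sum_subtractf power_divide power_add mult_ac)
  moreover have "(\<lambda>\<beta>. (\<Sum>is | length is = j. \<Sum>js | length js = j'. (b is * b' js) * ?c is js \<beta>) - ?q * \<beta> ^ (j + j'))
      \<in> O[at_right 0](\<lambda>\<beta>. \<beta> ^ off_order j j')"
  proof (intro sum_in_bigo(2) big_sum_in_bigo)
    fix "is" js :: "'d list" assume "is \<in> {is. length is = j}" "js \<in> {js. length js = j'}"
    then show "(\<lambda>\<beta>. (b is * b' js) * ?c is js \<beta>) \<in> O[at_right 0](\<lambda>\<beta>. \<beta> ^ off_order j j')"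
      using corr_lists_mean_bigo[of "is" js \<theta>] by (intro cmult_bigo) auto
  next
    \<comment> \<open>All features have order at least \<open>1\<close>, so the product of the two
      means has order at least \<open>2\<close> and is covered by \<open>off_order\<close>.\<close>
    have "(\<lambda>\<beta>. \<beta> ^ (j + j')) \<in> O[at_right 0](\<lambda>\<beta>::real. \<beta> ^ off_order j j')"
      using j by (intro power_bigo_at_right_0) (auto simp: off_order_def)
    then show "(\<lambda>\<beta>. ?q * \<beta> ^ (j + j')) \<in> O[at_right 0](\<lambda>\<beta>. \<beta> ^ off_order j j')"
      by (rule cmult_bigo)
  qed
  ultimately show ?thesis by (simp only: e fst_conv)
qed

end

section \<open>Inverses of perturbed diagonal matrices\<close>

primrec matpow :: "'i set \<Rightarrow> ('i \<Rightarrow> 'i \<Rightarrow> real) \<Rightarrow> nat \<Rightarrow> 'i \<Rightarrow> 'i \<Rightarrow> real" where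
  "matpow I N 0 = (\<lambda>i j. if i = j then 1 else 0)"
| "matpow I N (Suc n) = (\<lambda>i j. \<Sum>k\<in>I. N i k * matpow I N n k j)"

text \<open>The recursion multiplies on the left, which makes the Neumann series a right inverse;
  multiplication on the right makes it a left inverse as well.\<close>

lemma matpow_Suc_right:
  assumes "finite I" "i \<in> I" "j \<in> I"
  shows "matpow I N (Suc n) i j = (\<Sum>k\<in>I. matpow I N n i k * N k j)"
  using assms(2)
proof (induction n arbitrary: i)
  case 0
  have "(\<Sum>k\<in>I. N i k * (if k = j then 1 else 0)) = (\<Sum>k\<in>I. if k = j then N i k else 0)"
    "(\<Sum>k\<in>I. (if i = k then 1 else 0) * N k j) = (\<Sum>k\<in>I. if i = k then N k j else 0)"
    by (auto intro: sum.cong)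
  then show ?case using assms 0 by simp
next
  case (Suc n)
  have "matpow I N (Suc (Suc n)) i j = (\<Sum>k\<in>I. N i k * (\<Sum>l\<in>I. matpow I N n k l * N l j))"
    using Suc.IH by (subst matpow.simps(2)) (auto intro: sum.cong)
  also have "\<dots> = (\<Sum>l\<in>I. (\<Sum>k\<in>I. N i k * matpow I N n k l) * N l j)"
    by (simp add: sum_distrib_left sum_distrib_right mult.assoc) (rule sum.swap)
  finally show ?case by simp
qed

lemma matpow_bound:
  assumes "finite I" "0 \<le> q" and N: "\<And>i j. i \<in> I \<Longrightarrow> j \<in> I \<Longrightarrow> \<bar>N i j\<bar> \<le> q"
    and "i \<in> I" "j \<in> I"
  shows "\<bar>matpow I N n i j\<bar> \<le> (real (card I) * q) ^ n"
  using assms(4)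
proof (induction n arbitrary: i)
  case (Suc n)
  have "\<bar>matpow I N (Suc n) i j\<bar> \<le> (\<Sum>k\<in>I. \<bar>N i k * matpow I N n k j\<bar>)"
    by simp
  also have "\<dots> \<le> (\<Sum>k\<in>I. q * (real (card I) * q) ^ n)"
    using Suc N assms(2) by (intro sum_mono) (simp add: abs_mult mult_mono)
  finally show ?case by (simp add: mult_ac)
qed simp

definition mat_inverse_on :: "'i set \<Rightarrow> ('i \<Rightarrow> 'i \<Rightarrow> real) \<Rightarrow> ('i \<Rightarrow> 'i \<Rightarrow> real) \<Rightarrow> bool" where
  "mat_inverse_on I S S' \<longleftrightarrow> (\<forall>i\<in>I. \<forall>j\<in>I.
      (\<Sum>k\<in>I. S i k * S' k j) = (if i = j then 1 else 0) \<and>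
      (\<Sum>k\<in>I. S' i k * S k j) = (if i = j then 1 else 0))"

lemma inverse_on_works: "mat_inverse_on I S S' \<Longrightarrow> mat_inverse_on I S (inverse_on I S)"
  unfolding inverse_on_def mat_inverse_on_def[symmetric] by (rule someI[of "mat_inverse_on I S"])

lemma neumann_inverse:
  assumes fin: "finite I" and q: "0 \<le> q" "real (card I) * q < 1"
    and N: "\<And>i j. i \<in> I \<Longrightarrow> j \<in> I \<Longrightarrow> \<bar>N i j\<bar> \<le> q"
  shows "\<exists>S. mat_inverse_on I (\<lambda>i j. (if i = j then 1 else 0) - N i j) S"
proof -
  let ?P = "matpow I N"
  define S where "S = (\<lambda>i j. \<Sum>n. ?P n i j)"
  have sm: "summable (\<lambda>n. ?P n i j)" if "i \<in> I" "j \<in> I" for i j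
  proof (rule summable_comparison_test)
    show "\<exists>M. \<forall>n\<ge>M. norm (?P n i j) \<le> (real (card I) * q) ^ n"
      using matpow_bound[of I q N, OF fin q(1) N that] by auto
    show "summable (\<lambda>n. (real (card I) * q) ^ n)" using q by (intro summable_geometric) simp
  qed
  \<comment> \<open>The head of the series is the identity matrix and its tail is the series
    multiplied by \<open>N\<close>, from either side.\<close>
  have split: "S i j - (\<Sum>n. ?P (Suc n) i j) = (if i = j then 1 else 0)" if "i \<in> I" "j \<in> I" for i j
    using suminf_split_head[OF sm[OF that]] by (simp add: S_def del: matpow.simps(2))
  have "(\<Sum>k\<in>I. ((if i = k then 1 else 0) - N i k) * S k j) = (if i = j then 1 else 0)"
    "(\<Sum>k\<in>I. S i k * ((if k = j then 1 else 0) - N k j)) = (if i = j then 1 else 0)"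
    if ij: "i \<in> I" "j \<in> I" for i j
  proof -
    have "(\<Sum>n. ?P (Suc n) i j) = (\<Sum>k\<in>I. N i k * S k j)"
      using ij by (simp add: S_def suminf_sum sm summable_mult suminf_mult)
    moreover have "(\<Sum>k\<in>I. ((if i = k then 1 else 0) - N i k) * S k j) =
        (\<Sum>k\<in>I. (if i = k then S k j else 0) - N i k * S k j)"
      by (intro sum.cong) (auto simp: algebra_simps)
    ultimately show "(\<Sum>k\<in>I. ((if i = k then 1 else 0) - N i k) * S k j) = (if i = j then 1 else 0)"
      using split[OF ij] fin ij by (simp add: sum_subtractf)
    have "(\<Sum>n. ?P (Suc n) i j) = (\<Sum>k\<in>I. S i k * N k j)"
      using ij by (simp add: matpow_Suc_right[OF fin ij] S_def suminf_sum sm summable_mult2 suminf_mult2 del: matpow.simps(2))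
    moreover have "(\<Sum>k\<in>I. S i k * ((if k = j then 1 else 0) - N k j)) =
        (\<Sum>k\<in>I. (if k = j then S i k else 0) - S i k * N k j)"
      by (intro sum.cong) (auto simp: algebra_simps)
    ultimately show "(\<Sum>k\<in>I. S i k * ((if k = j then 1 else 0) - N k j)) = (if i = j then 1 else 0)"
      using split[OF ij] fin ij by (simp add: sum_subtractf)
  qed
  then show ?thesis unfolding mat_inverse_on_def by blast
qed

lemma diagonal_perturbation_inverse:
  assumes fin: "finite I" and d: "\<And>i. i \<in> I \<Longrightarrow> 0 < d i"
    and q: "0 \<le> q" "real (card I) * q < 1"
    and E: "\<And>i j. i \<in> I \<Longrightarrow> j \<in> I \<Longrightarrow> \<bar>S i j - (if i = j then d i else 0)\<bar> \<le> q * d i"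
  shows "mat_inverse_on I S (inverse_on I S)"
proof -
  \<comment> \<open>Dividing row \<open>i\<close> by \<open>d i\<close> brings \<open>S\<close> to
    the form identity minus \<open>N\<close>. The inverse of \<open>S\<close> is then the inverse of
    the scaled matrix with column \<open>j\<close> divided by \<open>d j\<close>.\<close>
  define N where "N = (\<lambda>i j. (if i = j then 1 else 0) - S i j / d i)"
  have "\<bar>N i j\<bar> \<le> q" if "i \<in> I" "j \<in> I" for i j
  proof -
    have "\<bar>N i j\<bar> = \<bar>S i j - (if i = j then d i else 0)\<bar> / d i"
      using d[OF that(1)] by (auto simp: N_def field_simps abs_if)
    then show ?thesis using E[OF that] d[OF that(1)] by (simp add: divide_le_eq)
  qed
  from neumann_inverse[where I = I and N = N, OF fin q this]
  obtain T where T: "mat_inverse_on I (\<lambda>i j. S i j / d i) T"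
    by (auto simp: N_def)
  have "mat_inverse_on I S (\<lambda>i j. T i j / d j)"
    unfolding mat_inverse_on_def
  proof (intro ballI conjI)
    fix i j assume ij: "i \<in> I" "j \<in> I"
    have "(\<Sum>k\<in>I. S i k * (T k j / d j)) = (\<Sum>k\<in>I. S i k / d i * T k j) * (d i / d j)"
      unfolding sum_distrib_right using d[OF ij(1)] by (intro sum.cong) auto
    then show "(\<Sum>k\<in>I. S i k * (T k j / d j)) = (if i = j then 1 else 0)"
      using T ij d[OF ij(1)] by (auto simp: mat_inverse_on_def)
    have "(\<Sum>k\<in>I. T i k / d k * S k j) = (\<Sum>k\<in>I. T i k * (S k j / d k))"
      by simp
    then show "(\<Sum>k\<in>I. T i k / d k * S k j) = (if i = j then 1 else 0)"
      using T ij by (simp add: mat_inverse_on_def)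
  qed
  then show ?thesis by (rule inverse_on_works)
qed

text \<open>Only a first-order expansion is needed: products of two entries of the perturbation are
  already \<open>O(\<beta>\<^sup>2)\<close>, so the \<open>(i, j)\<close> entry of the inverse inherits the order of the \<open>(i, j)\<close> entry
  of the perturbation.\<close>

lemma inverse_on_bigo:
  fixes C :: "real \<Rightarrow> 'i \<Rightarrow> 'i \<Rightarrow> real"
  assumes fin: "finite I" and d: "\<And>i. i \<in> I \<Longrightarrow> 0 < d i"
    and e: "\<And>i j. e i j = 1 \<or> e i j = (2::nat)"
    and C: "\<And>i j. i \<in> I \<Longrightarrow> j \<in> I \<Longrightarrow>
      (\<lambda>\<beta>. C \<beta> i j - (if i = j then d i else 0)) \<in> O[at_right 0](\<lambda>\<beta>. \<beta> ^ e i j)"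
    and ij: "i \<in> I" "j \<in> I"
  shows "(\<lambda>\<beta>. inverse_on I (C \<beta>) i j - (if i = j then 1 / d i else 0)) \<in> O[at_right 0](\<lambda>\<beta>. \<beta> ^ e i j)"
proof -
  let ?F = "at_right (0::real)"
  let ?S = "\<lambda>\<beta>. inverse_on I (C \<beta>)"
  let ?E = "\<lambda>\<beta> i j. C \<beta> i j - (if i = j then d i else 0)"
  let ?R = "\<lambda>\<beta> i j. ?S \<beta> i j - (if i = j then 1 / d i else 0)"
  \<comment> \<open>Convergence of the Neumann series needs \<open>card I * q < 1\<close>; the bound
    \<open>1 / 2\<close> is chosen so that half of the largest entry can be absorbed in
    \<open>S1\<close>.\<close>
  define q where "q = 1 / (2 * (real (card I) + 1))"
  have q: "0 < q" "real (card I) * q \<le> 1 / 2" by (auto simp: q_def field_simps)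
  have E1: "(\<lambda>\<beta>. ?E \<beta> i j) \<in> O[?F](\<lambda>\<beta>. \<beta>)" if "i \<in> I" "j \<in> I" for i j
    using landau_o.big_trans[OF C[OF that] power_bigo_at_right_0[of 1]] e[of i j] by auto
  \<comment> \<open>The minimum makes the error small relative to the row, as
    \<open>diagonal_perturbation_inverse\<close> asks, and relative to the column, where
    \<open>key\<close> divides by \<open>d j\<close>.\<close>
  have "\<forall>\<^sub>F \<beta> in ?F. \<forall>p\<in>I\<times>I. \<bar>?E \<beta> (fst p) (snd p)\<bar> \<le> q * min (d (fst p)) (d (snd p))"
  proof (rule eventually_ball_finite)
    show "finite (I \<times> I)" using fin by simp
    show "\<forall>p\<in>I\<times>I. \<forall>\<^sub>F \<beta> in ?F. \<bar>?E \<beta> (fst p) (snd p)\<bar> \<le> q * min (d (fst p)) (d (snd p))"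
    proof
      fix p assume p: "p \<in> I \<times> I"
      define \<epsilon> where "\<epsilon> = q * min (d (fst p)) (d (snd p))"
      have \<epsilon>: "0 < \<epsilon>" using p q d by (auto simp: \<epsilon>_def)
      have "(\<lambda>\<beta>. ?E \<beta> (fst p) (snd p)) \<in> O[?F](\<lambda>\<beta>. \<beta>)" by (intro E1) (use p in auto)
      then obtain c where c: "0 < c" "\<forall>\<^sub>F \<beta> in ?F. norm (?E \<beta> (fst p) (snd p)) \<le> c * norm \<beta>"
        by (rule landau_o.bigE)
      have "\<forall>\<^sub>F \<beta> in ?F. 0 < \<beta> \<and> \<beta> < \<epsilon> / c"
        using \<epsilon> c(1) by (auto simp: eventually_at_right_field intro!: exI[of _ "\<epsilon> / c"])
      with c(2) have "\<forall>\<^sub>F \<beta> in ?F. \<bar>?E \<beta> (fst p) (snd p)\<bar> \<le> \<epsilon>"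
      proof eventually_elim
        case (elim \<beta>)
        then have "c * norm \<beta> \<le> \<epsilon>" using c(1) by (simp add: field_simps)
        with elim show ?case by simp
      qed
      then show "\<forall>\<^sub>F \<beta> in ?F. \<bar>?E \<beta> (fst p) (snd p)\<bar> \<le> q * min (d (fst p)) (d (snd p))"
        by (simp only: \<epsilon>_def)
    qed
  qed
  then have ev: "\<forall>\<^sub>F \<beta> in ?F. \<forall>i\<in>I. \<forall>j\<in>I. \<bar>?E \<beta> i j\<bar> \<le> q * d i \<and> \<bar>?E \<beta> i j\<bar> \<le> q * d j"
  proof eventually_elim
    case (elim \<beta>)
    show ?case
    proof (intro ballI)
      fix i j assume ij: "i \<in> I" "j \<in> I"
      have "q * min (d i) (d j) \<le> q * d i" "q * min (d i) (d j) \<le> q * d j"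
        using q by (auto intro: mult_left_mono)
      with elim ij show "\<bar>?E \<beta> i j\<bar> \<le> q * d i \<and> \<bar>?E \<beta> i j\<bar> \<le> q * d j" by fastforce
    qed
  qed
  \<comment> \<open>Write \<open>C\<close> as diagonal plus \<open>?E\<close> in the equation saying
    that \<open>?S\<close> is a left inverse, and solve for \<open>?S\<close>.\<close>
  have key: "?R \<beta> i j = - (\<Sum>k\<in>I. ?S \<beta> i k * (?E \<beta> k j / d j))"
    if inv: "mat_inverse_on I (C \<beta>) (?S \<beta>)" and ij: "i \<in> I" "j \<in> I" for \<beta> i j
  proof -
    have "(if i = j then 1 else 0) = (\<Sum>k\<in>I. ?S \<beta> i k * C \<beta> k j)"
      using inv ij by (simp add: mat_inverse_on_def)
    also have "\<dots> = (\<Sum>k\<in>I. ?S \<beta> i k * ?E \<beta> k j + (if k = j then ?S \<beta> i k * d k else 0))"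
      by (intro sum.cong) (auto simp: algebra_simps)
    also have "\<dots> = (\<Sum>k\<in>I. ?S \<beta> i k * ?E \<beta> k j) + ?S \<beta> i j * d j"
      using fin ij by (simp add: sum.distrib)
    finally have "?S \<beta> i j = (if i = j then 1 / d j else 0) - (\<Sum>k\<in>I. ?S \<beta> i k * ?E \<beta> k j) / d j"
      using d[OF ij(2)] by (auto simp: field_simps)
    then show ?thesis by (simp add: sum_divide_distrib)
  qed
  have inv: "\<forall>\<^sub>F \<beta> in ?F. mat_inverse_on I (C \<beta>) (?S \<beta>)"
    using ev by eventually_elim (rule diagonal_perturbation_inverse[where d = d and q = q, OF fin d], use q in auto)
  have S1: "(\<lambda>\<beta>. ?S \<beta> i j) \<in> O[?F](\<lambda>_. 1)" if ij: "i \<in> I" "j \<in> I" for i j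
  proof (rule bigoI)
    let ?D = "\<Sum>i\<in>I. 1 / d i"
    show "\<forall>\<^sub>F \<beta> in ?F. norm (?S \<beta> i j) \<le> (2 * ?D) * norm (1::real)"
      using ev inv
    proof eventually_elim
      case (elim \<beta>)
      \<comment> \<open>Apply \<open>key\<close> at the column \<open>l\<close> of the largest entry
        of row \<open>i\<close>: this gives \<open>?m \<le> ?D + ?m / 2\<close>, hence a bound
        independent of \<open>\<beta>\<close>.\<close>
      let ?m = "Max ((\<lambda>j. \<bar>?S \<beta> i j\<bar>) ` I)"
      have m: "\<bar>?S \<beta> i k\<bar> \<le> ?m" if "k \<in> I" for k using fin that by simp
      have "?m \<in> (\<lambda>j. \<bar>?S \<beta> i j\<bar>) ` I" using fin ij by (intro Max_in) auto
      then obtain l where l: "l \<in> I" "?m = \<bar>?S \<beta> i l\<bar>" by auto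
      have "\<bar>?S \<beta> i l\<bar> \<le> \<bar>if i = l then 1 / d i else 0\<bar> + \<bar>\<Sum>k\<in>I. ?S \<beta> i k * (?E \<beta> k l / d l)\<bar>"
        using key[OF elim(2) ij(1) l(1)] by linarith
      moreover have "\<bar>if i = l then 1 / d i else 0\<bar> \<le> ?D"
      proof -
        have "1 / d i \<le> ?D" using fin ij d by (intro member_le_sum) (auto intro: less_imp_le)
        moreover have "0 < 1 / d i" using d ij by simp
        ultimately have "0 \<le> ?D" "\<bar>1 / d i\<bar> \<le> ?D" by linarith+
        then show ?thesis by (cases "i = l") (simp_all only: if_True if_False abs_zero simp_thms)
      qed
      moreover have "\<bar>\<Sum>k\<in>I. ?S \<beta> i k * (?E \<beta> k l / d l)\<bar> \<le> (\<Sum>k\<in>I. ?m * q)"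
      proof (rule order_trans[OF sum_abs sum_mono])
        fix k assume k: "k \<in> I"
        have "\<bar>?E \<beta> k l / d l\<bar> \<le> q" using elim(1) k l d[OF l(1)] by (simp add: abs_divide divide_le_eq)
        then show "\<bar>?S \<beta> i k * (?E \<beta> k l / d l)\<bar> \<le> ?m * q"
          unfolding abs_mult using m[OF k] by (intro mult_mono) auto
      qed
      moreover have "(\<Sum>k\<in>I. ?m * q) \<le> ?m / 2"
        using mult_left_mono[OF q(2), of ?m] m[OF ij(1)] by (simp add: mult_ac)
      ultimately have "?m \<le> 2 * ?D" using l(2) by linarith
      then show ?case using m[OF ij(2)] by simp
    qed
  qed
  \<comment> \<open>Boundedness of \<open>?S\<close> in \<open>key\<close> gives a first, uniform
    order for the deviation \<open>?R\<close>.\<close>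
  have R1: "(\<lambda>\<beta>. ?R \<beta> i j) \<in> O[?F](\<lambda>\<beta>. \<beta>)" if ij: "i \<in> I" "j \<in> I" for i j
  proof -
    have "(\<lambda>\<beta>. - (\<Sum>k\<in>I. ?S \<beta> i k * (?E \<beta> k j / d j))) \<in> O[?F](\<lambda>\<beta>. \<beta>)"
      unfolding landau_o.big.uminus_in_iff
    proof (rule big_sum_in_bigo)
      fix k assume k: "k \<in> I"
      have "(\<lambda>\<beta>. 1 / d j * ?E \<beta> k j) \<in> O[?F](\<lambda>\<beta>. \<beta>)" by (intro cmult_bigo E1 k ij)
      from landau_o.big_mult[OF S1[OF ij(1) k] this]
      show "(\<lambda>\<beta>. ?S \<beta> i k * (?E \<beta> k j / d j)) \<in> O[?F](\<lambda>\<beta>. \<beta>)" by simp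
    qed
    moreover have "\<forall>\<^sub>F \<beta> in ?F. ?R \<beta> i j = - (\<Sum>k\<in>I. ?S \<beta> i k * (?E \<beta> k j / d j))"
      using inv by eventually_elim (rule key[OF _ ij])
    ultimately show ?thesis by (simp only: landau_o.big.in_cong)
  qed
  \<comment> \<open>Substituting \<open>?S\<close> as diagonal plus \<open>?R\<close> back into
    \<open>key\<close> isolates the \<open>(i, j)\<close> entry of the error; what remains are
    products \<open>?R * ?E\<close>, already quadratic by \<open>R1\<close> and
    \<open>E1\<close>.\<close>
  have "\<forall>\<^sub>F \<beta> in ?F. ?R \<beta> i j = - (1 / (d i * d j) * ?E \<beta> i j + (\<Sum>k\<in>I. 1 / d j * (?R \<beta> i k * ?E \<beta> k j)))"
    using inv
  proof eventually_elim
    case (elim \<beta>)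
    have "(\<Sum>k\<in>I. ?S \<beta> i k * (?E \<beta> k j / d j)) =
        (\<Sum>k\<in>I. (if i = k then 1 / (d i * d j) * ?E \<beta> k j else 0) + 1 / d j * (?R \<beta> i k * ?E \<beta> k j))"
    proof (intro sum.cong refl)
      fix k
      have "s * (x / d j) = (if i = k then 1 / (d i * d j) * x else 0)
          + 1 / d j * ((s - (if i = k then 1 / d i else 0)) * x)" for s x
        using d[OF ij(1)] d[OF ij(2)] by (auto simp: field_simps)
      then show "?S \<beta> i k * (?E \<beta> k j / d j) =
          (if i = k then 1 / (d i * d j) * ?E \<beta> k j else 0) + 1 / d j * (?R \<beta> i k * ?E \<beta> k j)" .
    qed
    also have "\<dots> = 1 / (d i * d j) * ?E \<beta> i j + (\<Sum>k\<in>I. 1 / d j * (?R \<beta> i k * ?E \<beta> k j))"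
      using fin ij by (simp add: sum.distrib)
    finally show ?case using key[OF elim ij] by simp
  qed
  moreover have "(\<lambda>\<beta>. - (1 / (d i * d j) * ?E \<beta> i j + (\<Sum>k\<in>I. 1 / d j * (?R \<beta> i k * ?E \<beta> k j))))
      \<in> O[?F](\<lambda>\<beta>. \<beta> ^ e i j)"
    unfolding landau_o.big.uminus_in_iff
  proof (intro sum_in_bigo(1) big_sum_in_bigo cmult_bigo)
    show "(\<lambda>\<beta>. ?E \<beta> i j) \<in> O[?F](\<lambda>\<beta>. \<beta> ^ e i j)" by (rule C[OF ij])
    fix k assume k: "k \<in> I"
    have "(\<lambda>\<beta>. ?R \<beta> i k * ?E \<beta> k j) \<in> O[?F](\<lambda>\<beta>. \<beta> * \<beta>)"
      by (intro landau_o.big_mult R1 E1 ij k)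
    moreover have "(\<lambda>\<beta>. \<beta> * \<beta>) \<in> O[?F](\<lambda>\<beta>::real. \<beta> ^ e i j)"
      using power_bigo_at_right_0[of "e i j" 2] e[of i j] by (auto simp: power2_eq_square)
    ultimately show "(\<lambda>\<beta>. ?R \<beta> i k * ?E \<beta> k j) \<in> O[?F](\<lambda>\<beta>. \<beta> ^ e i j)"
      by (rule landau_o.big_trans)
  qed
  ultimately show ?thesis by (simp only: landau_o.big.in_cong)
qed

text \<open>Riesz representation on \<open>W\<close>: represent the functional on the whole space by
  its adjoint at \<open>1\<close> and project to \<open>W\<close>. Two representing vectors differ
  by an element of \<open>W\<close> that is orthogonal to itself, which justifies
  \<open>THE\<close>.\<close>

lemma transpose_on_works:
  fixes D :: "'a::euclidean_space \<Rightarrow> 'i \<Rightarrow> real"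
  assumes W: "subspace W" and D: "\<And>i. i \<in> I \<Longrightarrow> linear (\<lambda>h. D h i)" and h: "h \<in> W"
  shows "h \<bullet> transpose_on W I D x = (\<Sum>i\<in>I. D h i * x i)"
proof -
  let ?f = "\<lambda>h. \<Sum>i\<in>I. D h i * x i"
  have "linear ?f"
    by (intro linear_compose_sum ballI) (use D in \<open>auto simp: linear_iff algebra_simps\<close>)
  then have a: "h \<bullet> adjoint ?f 1 = ?f h" for h
    using adjoint_works[of ?f h 1] by simp
  obtain v u where v: "v \<in> span W" and u: "\<And>w. w \<in> span W \<Longrightarrow> orthogonal u w"
    and s: "adjoint ?f 1 = v + u"
    using orthogonal_subspace_decomp_exists by blast
  have sp: "span W = W" using W by (simp add: span_eq_iff)
  have v: "v \<in> W \<and> (\<forall>h\<in>W. h \<bullet> v = ?f h)"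
  proof (intro conjI ballI)
    show "v \<in> W" using v sp by simp
    fix h assume "h \<in> W"
    then have "h \<bullet> u = 0" using u[of h] sp by (simp add: orthogonal_def inner_commute)
    then show "h \<bullet> v = ?f h" using a[of h] by (simp add: s inner_add_right)
  qed
  have "v' = v" if v': "v' \<in> W \<and> (\<forall>h\<in>W. h \<bullet> v' = ?f h)" for v'
  proof -
    have "v' - v \<in> W" using v v' W by (blast intro: subspace_diff)
    then have "(v' - v) \<bullet> (v' - v) = 0" using v v' by (subst inner_diff_right) simp
    then show ?thesis by simp
  qed
  with v have "transpose_on W I D x \<in> W \<and> (\<forall>h\<in>W. h \<bullet> transpose_on W I D x = ?f h)"
    unfolding transpose_on_def by (rule theI)
  then show ?thesis using h by blast
qed

section \<open>The layer expansion\<close>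

text \<open>Expand \<open>t\<close> in the basis; orthonormality identifies its coefficients. This
  makes the leading term independent of the choice of \<open>B\<close>.\<close>

lemma frob_parseval:
  fixes s :: "'d::finite tensor"
  assumes B: "sym_orthonormal_basis j B" and t: "t \<in> sym_tensors j"
  shows "(\<Sum>b\<in>B. frob j s b * frob j t b) = frob j s t"
proof -
  obtain c where c: "t = (\<lambda>is. \<Sum>b\<in>B. c b * b is)"
    using B t unfolding sym_orthonormal_basis_def by blast
  have fin: "finite B" and on: "\<And>b b'. b \<in> B \<Longrightarrow> b' \<in> B \<Longrightarrow> frob j b b' = (if b = b' then 1 else 0)"
    using B by (auto simp: sym_orthonormal_basis_def)
  have l: "frob j t x = (\<Sum>b\<in>B. c b * frob j b x)" for x
    unfolding frob_def c by (simp add: sum_distrib_left sum_distrib_right mult.assoc) (rule sum.swap)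
  have comm: "frob j x y = frob j y x" for x y :: "'d tensor" by (simp add: frob_def mult.commute)
  have "frob j t b = c b" if "b \<in> B" for b
  proof -
    have "frob j t b = (\<Sum>b'\<in>B. if b' = b then c b' else 0)"
      unfolding l using that by (intro sum.cong) (auto simp: on)
    then show ?thesis using fin that by simp
  qed
  then have "(\<Sum>b\<in>B. frob j s b * frob j t b) = (\<Sum>b\<in>B. c b * frob j b s)"
    by (intro sum.cong) (auto simp: comm[of s])
  then show ?thesis using l[of s] comm[of t s] by simp
qed

section \<open>Derivatives of the moments, and the expansion of the information\<close>

context linear_mixture
begin

text \<open>A class of weights closed under products, contained in the integrable functions and
  containing the entries of \<open>A\<close>, as the induction in
  \<open>weighted_moment_differentiable\<close> requires.\<close>

definition ess_bounded :: "('z \<Rightarrow> real) \<Rightarrow> bool" where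
  "ess_bounded w \<longleftrightarrow> w \<in> borel_measurable \<mu> \<and> (\<exists>K. AE z in \<mu>. \<bar>w z\<bar> \<le> K)"

lemma ess_bounded_integrable: "ess_bounded w \<Longrightarrow> integrable \<mu> w"
  unfolding ess_bounded_def real_norm_def[symmetric] by (blast intro: integrable_const_bound)

lemma ess_bounded_const: "ess_bounded (\<lambda>_. c)"
  unfolding ess_bounded_def by auto

lemma ess_bounded_mult:
  assumes "ess_bounded v" "ess_bounded w"
  shows "ess_bounded (\<lambda>z. v z * w z)"
proof -
  obtain K L where K: "AE z in \<mu>. \<bar>v z\<bar> \<le> K" and L: "AE z in \<mu>. \<bar>w z\<bar> \<le> L"
    using assms by (auto simp: ess_bounded_def)
  have "AE z in \<mu>. \<bar>v z * w z\<bar> \<le> K * L"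
    using K L by eventually_elim (simp add: abs_mult mult_mono)
  then show ?thesis using assms by (auto simp: ess_bounded_def)
qed

lemma ess_bounded_entry: "ess_bounded (\<lambda>z. A z $ i $ m)"
proof -
  have "continuous_on UNIV (\<lambda>M::real^'m^'d. M $ i $ m)" by (intro continuous_intros)
  then have "(\<lambda>z. A z $ i $ m) \<in> borel_measurable \<mu>"
    by (rule measurable_compose[OF A_measurable borel_measurable_continuous_onI])
  moreover have "AE z in \<mu>. \<bar>A z $ i $ m\<bar> \<le> amax"
    using A_bounded
  proof eventually_elim
    case (elim z)
    have "\<bar>A z $ i $ m\<bar> \<le> norm (column m (A z))"
      using component_le_norm_cart[of "column m (A z)" i] by (simp add: column_def)
    then show ?case using norm_column_le_onorm[of m "A z"] elim by linarith
  qed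
  ultimately show ?thesis by (auto simp: ess_bounded_def)
qed

lemma ess_bounded_coordinate: "ess_bounded (\<lambda>z. (A z *v \<theta>) $ i)"
proof -
  have "(\<lambda>z. (A z *v \<theta>) $ i) \<in> borel_measurable \<mu>"
    by (rule measurable_compose[OF A_mult_measurable borel_measurable_continuous_onI])
      (intro continuous_intros)
  moreover have "AE z in \<mu>. \<bar>(A z *v \<theta>) $ i\<bar> \<le> amax * norm \<theta>"
    using A_mult_bounded[of \<theta>] by eventually_elim (rule order_trans[OF component_le_norm_cart])
  ultimately show ?thesis by (auto simp: ess_bounded_def)
qed

lemma ess_bounded_monomial: "ess_bounded (\<lambda>z. \<Prod>i\<leftarrow>is. (A z *v \<theta>) $ i)"
  by (induction "is") (auto intro: ess_bounded_const ess_bounded_mult ess_bounded_coordinate)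

text \<open>Each factor is a finite sum of entries of \<open>A\<close> times coordinates of
  \<open>\<theta>\<close>: the coordinate leaves the integral and the entry joins the weight. So the
  moment is built from coordinates by sums and products, and no differentiation under the integral
  occurs.\<close>

lemma weighted_moment_differentiable:
  assumes "ess_bounded w"
  shows "(\<lambda>\<theta>. \<integral>z. w z * (\<Prod>i\<leftarrow>is. (A z *v \<theta>) $ i) \<partial>\<mu>) differentiable at \<theta>"
  using assms
proof (induction "is" arbitrary: w)
  case Nil
  then show ?case by simp
next
  case (Cons i "is")
  let ?w = "\<lambda>m z. w z * A z $ i $ m"
  have w: "ess_bounded (?w m)" for m using Cons.prems by (intro ess_bounded_mult ess_bounded_entry)
  have int: "integrable \<mu> (\<lambda>z. ?w m z * (\<Prod>i\<leftarrow>is. (A z *v \<theta>) $ i))" for m \<theta>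
    by (intro ess_bounded_integrable ess_bounded_mult[OF w] ess_bounded_monomial)
  have "(\<integral>z. w z * (\<Prod>i\<leftarrow>i # is. (A z *v \<theta>) $ i) \<partial>\<mu>) =
      (\<Sum>m\<in>UNIV. \<theta> $ m * (\<integral>z. ?w m z * (\<Prod>i\<leftarrow>is. (A z *v \<theta>) $ i) \<partial>\<mu>))" for \<theta>
  proof -
    have "(\<integral>z. w z * (\<Prod>i\<leftarrow>i # is. (A z *v \<theta>) $ i) \<partial>\<mu>) =
        (\<integral>z. (\<Sum>m\<in>UNIV. \<theta> $ m * (?w m z * (\<Prod>i\<leftarrow>is. (A z *v \<theta>) $ i))) \<partial>\<mu>)"
      by (intro Bochner_Integration.integral_cong refl)
        (simp add: matrix_vector_mult_def sum_distrib_left sum_distrib_right mult_ac)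
    then show ?thesis using int by (simp add: Bochner_Integration.integral_sum)
  qed
  moreover have "(\<lambda>\<theta>. \<theta> $ m) differentiable at \<theta>" for m and \<theta> :: "real^'m"
    using bounded_linear_imp_differentiable[OF bounded_linear_vec_nth] .
  ultimately show ?case
    using Cons.IH[OF w] by (auto intro!: differentiable_sum differentiable_mult)
qed

lemma moment_T_differentiable: "(\<lambda>\<theta>. moment_T \<mu> A k \<theta> is) differentiable at \<theta>"
  using weighted_moment_differentiable[OF ess_bounded_const[of 1], of "is" \<theta>]
  by (cases "length is = k") (simp_all add: moment_T_def tensor_power_def)

lemma moment_T_has_derivative:
  "((\<lambda>\<theta>. moment_T \<mu> A k \<theta> is) has_derivative (\<lambda>h. DT \<mu> A \<theta> k h is)) (at \<theta>)"
  using moment_T_differentiable[of k "is" \<theta>] unfolding DT_def frechet_derivative_works by simp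

lemma mean_M_has_derivative:
  "((\<lambda>\<theta>. mean_M \<mu> A \<sigma> \<theta> \<beta> (j, b)) has_derivative
      (\<lambda>h. (\<beta> / \<sigma>) ^ j * frob j (DT \<mu> A \<theta> j h) b)) (at \<theta>)"
  unfolding mean_M_eq frob_def
  by (intro has_derivative_mult_right has_derivative_sum has_derivative_mult_left moment_T_has_derivative)

lemma DM_eq: "DM \<mu> A \<sigma> \<theta> \<beta> h (j, b) = (\<beta> / \<sigma>) ^ j * frob j (DT \<mu> A \<theta> j h) b"
  using frechet_derivative_at[OF mean_M_has_derivative, symmetric] by (simp add: DM_def)

lemma linear_DM: "linear (\<lambda>h. DM \<mu> A \<sigma> \<theta> \<beta> h i)"
  using has_derivative_linear[OF mean_M_has_derivative] by (cases i) (simp add: DM_eq)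

lemma DT_sym: "DT \<mu> A \<theta> k h \<in> sym_tensors k"
  unfolding sym_tensors_def
proof (intro CollectI conjI allI impI)
  fix "is" :: "'d list" assume "length is \<noteq> k"
  then show "DT \<mu> A \<theta> k h is = 0"
    by (simp add: DT_def moment_T_def tensor_power_def)
next
  fix "is" js :: "'d list" assume m: "mset is = mset js"
  then have l: "length is = length js" by (rule mset_eq_length)
  have "(\<Prod>i\<leftarrow>is. x $ i) = (\<Prod>i\<leftarrow>js. x $ i)" for x :: "real^'d"
    using m by (metis mset_map prod_mset_prod_list)
  then have "moment_T \<mu> A k \<theta> is = moment_T \<mu> A k \<theta> js" for \<theta>
    by (simp add: moment_T_def tensor_power_def l cong: if_cong)
  then show "DT \<mu> A \<theta> k h is = DT \<mu> A \<theta> k h js" by (simp add: DT_def)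
qed

text \<open>The exponent is left open so that one expansion serves all cases. Assumption
  \<open>e\<close> counts powers in the deviation of the inverse covariance from its diagonal limit;
  \<open>e'\<close> does so in that limit, outside the leading block
  \<open>i = k = l\<close>.\<close>

lemma gmom_info_expansion:
  fixes B :: "nat \<Rightarrow> 'd tensor set"
  assumes B: "\<And>j. sym_orthonormal_basis j (B j)"
    and h: "h \<in> layer_V \<mu> A \<Theta> \<theta> k" and g: "g \<in> layer_V \<mu> A \<Theta> \<theta> l"
    and L: "1 \<le> k" "k \<le> L"
    and e: "\<And>i j. k \<le> i \<Longrightarrow> l \<le> j \<Longrightarrow> e \<le> i + j + off_order i j"
    and e': "\<And>i. k \<le> i \<Longrightarrow> l \<le> i \<Longrightarrow> \<not> (i = k \<and> i = l) \<Longrightarrow> e \<le> 2 * i"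
  shows "(\<lambda>\<beta>. h \<bullet> gmom_info \<mu> A \<sigma> \<Theta> L B \<theta> \<beta> g
      - (if k = l then snr \<sigma> \<beta> ^ k / fact k * frob k (DT \<mu> A \<theta> k h) (DT \<mu> A \<theta> k g) else 0))
      \<in> O[at_right 0](\<lambda>\<beta>. \<beta> ^ e)"
proof -
  let ?I = "feats L B"
  let ?S = "\<lambda>\<beta>. inverse_on ?I (cov_Sigma \<mu> A \<sigma> \<theta> \<beta>)"
  let ?\<delta> = "\<lambda>i j. if i = j then 1 / fact (fst i) else 0 :: real"
  define a where "a = (\<lambda>h i. frob (fst i) (DT \<mu> A \<theta> (fst i) h) (snd i))"
  have finB: "finite (B j)" for j using B by (simp add: sym_orthonormal_basis_def)
  then have fin: "finite ?I" by (simp add: feats_def)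
  have fI: "1 \<le> fst i" if "i \<in> ?I" for i using that by (auto simp: feats_def)
  have DM: "DM \<mu> A \<sigma> \<theta> \<beta> x i = (\<beta> / \<sigma>) ^ fst i * a x i" for \<beta> x i
    by (cases i) (simp add: DM_eq a_def)
  \<comment> \<open>Contrapositive of the vanishing that defines the filtration. It speaks of orders
    \<open>j \<ge> 1\<close>, and \<open>fI\<close> places every feature there.\<close>
  have van: "k' \<le> fst i" if "x \<in> layer_V \<mu> A \<Theta> \<theta> k'" "i \<in> ?I" "a x i \<noteq> 0" for x k' i
  proof (rule ccontr)
    assume "\<not> k' \<le> fst i"
    then have "DT \<mu> A \<theta> (fst i) x = (\<lambda>_. 0)" using that(1) fI[OF that(2)] by (auto simp: layer_V_def)
    then show False using that(3) by (simp add: a_def frob_def)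
  qed
  have R: "(\<lambda>\<beta>. ?S \<beta> i j - ?\<delta> i j) \<in> O[at_right 0](\<lambda>\<beta>. \<beta> ^ off_order (fst i) (fst j))"
    if "i \<in> ?I" "j \<in> ?I" for i j
  proof (rule inverse_on_bigo[where C = "cov_Sigma \<mu> A \<sigma> \<theta>" and d = "\<lambda>i. fact (fst i)"
        and e = "\<lambda>i j. off_order (fst i) (fst j)", OF fin _ _ _ that])
    show "off_order (fst i) (fst j) = 1 \<or> off_order (fst i) (fst j) = 2" for i j :: "'d feat"
      by (simp add: off_order_def)
    show "(\<lambda>\<beta>. cov_Sigma \<mu> A \<sigma> \<theta> \<beta> i j - (if i = j then fact (fst i) else 0))
        \<in> O[at_right 0](\<lambda>\<beta>. \<beta> ^ off_order (fst i) (fst j))" if "i \<in> ?I" "j \<in> ?I" for i j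
      by (rule cov_Sigma_bigo[OF B that])
  qed simp
  have hW: "h \<in> normal_W \<mu> A \<Theta> \<theta>" using h by (simp add: layer_V_def)
  have main: "(if k = l then snr \<sigma> \<beta> ^ k / fact k * frob k (DT \<mu> A \<theta> k h) (DT \<mu> A \<theta> k g) else 0) =
      (\<Sum>i\<in>?I. if fst i = k \<and> k = l then (\<beta> / \<sigma>) ^ (2 * fst i) * a h i * a g i / fact (fst i) else 0)"
    (is "?lhs = ?rhs") for \<beta>
  proof (cases "k = l")
    case True
    have "?rhs = (\<Sum>i\<in>?I \<inter> {i. fst i = k}. (\<beta> / \<sigma>) ^ (2 * k) * a h i * a g i / fact k)"
      using fin True by (simp add: sum.inter_restrict) (intro sum.cong, auto)
    \<comment> \<open>Since \<open>1 \<le> k \<le> L\<close>, the whole block of order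
      \<open>k\<close> is among the features, and Parseval's identity applies to it.\<close>
    also have "?I \<inter> {i. fst i = k} = Pair k ` B k" using L by (auto simp: feats_def)
    also have "(\<Sum>i\<in>Pair k ` B k. (\<beta> / \<sigma>) ^ (2 * k) * a h i * a g i / fact k) =
        (\<beta> / \<sigma>) ^ (2 * k) / fact k * (\<Sum>b\<in>B k. frob k (DT \<mu> A \<theta> k h) b * frob k (DT \<mu> A \<theta> k g) b)"
      by (subst sum.reindex) (auto simp: inj_on_def a_def sum_distrib_left mult_ac)
    also have "\<dots> = ?lhs"
      using True by (simp add: frob_parseval[OF B DT_sym] snr_def power_divide power_mult)
    finally show ?thesis ..
  qed simp
  \<comment> \<open>The first sum carries the deviation of the inverse covariance from its diagonal
    limit, the second the diagonal blocks without the leading one.\<close>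
  have expand: "h \<bullet> gmom_info \<mu> A \<sigma> \<Theta> L B \<theta> \<beta> g
      - (if k = l then snr \<sigma> \<beta> ^ k / fact k * frob k (DT \<mu> A \<theta> k h) (DT \<mu> A \<theta> k g) else 0) =
     (\<Sum>i\<in>?I. \<Sum>j\<in>?I. (a h i * a g j / \<sigma> ^ (fst i + fst j)) * (\<beta> ^ (fst i + fst j) * (?S \<beta> i j - ?\<delta> i j))) +
     (\<Sum>i\<in>?I. (if fst i = k \<and> k = l then 0 else a h i * a g i / fact (fst i) / \<sigma> ^ (2 * fst i)) * \<beta> ^ (2 * fst i))"
    for \<beta>
  proof -
    have "h \<bullet> gmom_info \<mu> A \<sigma> \<Theta> L B \<theta> \<beta> g =
        (\<Sum>i\<in>?I. DM \<mu> A \<sigma> \<theta> \<beta> h i * (\<Sum>j\<in>?I. ?S \<beta> i j * DM \<mu> A \<sigma> \<theta> \<beta> g j))"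
      unfolding gmom_info_def Let_def
      by (rule transpose_on_works[OF _ linear_DM hW]) (simp add: normal_W_def subspace_orthogonal_comp)
    also have "\<dots> = (\<Sum>i\<in>?I. \<Sum>j\<in>?I.
        (a h i * a g j / \<sigma> ^ (fst i + fst j)) * (\<beta> ^ (fst i + fst j) * (?S \<beta> i j - ?\<delta> i j)) +
        (if i = j then (\<beta> / \<sigma>) ^ (2 * fst i) * a h i * a g i / fact (fst i) else 0))"
      unfolding sum_distrib_left DM
      by (intro sum.cong refl)
        (auto simp: power_divide power_add power_mult power2_eq_square power_mult_distrib right_diff_distrib mult_ac)
    also have "\<dots> = (\<Sum>i\<in>?I. \<Sum>j\<in>?I.
        (a h i * a g j / \<sigma> ^ (fst i + fst j)) * (\<beta> ^ (fst i + fst j) * (?S \<beta> i j - ?\<delta> i j))) +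
        (\<Sum>i\<in>?I. (\<beta> / \<sigma>) ^ (2 * fst i) * a h i * a g i / fact (fst i))"
      using fin by (simp add: sum.distrib)
    finally have 1: "h \<bullet> gmom_info \<mu> A \<sigma> \<Theta> L B \<theta> \<beta> g = \<dots>" .
    have 2: "(\<Sum>i\<in>?I. (\<beta> / \<sigma>) ^ (2 * fst i) * a h i * a g i / fact (fst i)) -
        (\<Sum>i\<in>?I. if fst i = k \<and> k = l then (\<beta> / \<sigma>) ^ (2 * fst i) * a h i * a g i / fact (fst i) else 0) =
        (\<Sum>i\<in>?I. (if fst i = k \<and> k = l then 0 else a h i * a g i / fact (fst i) / \<sigma> ^ (2 * fst i)) * \<beta> ^ (2 * fst i))"
      unfolding sum_subtractf[symmetric] by (intro sum.cong refl) (auto simp: power_divide mult_ac)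
    show ?thesis
      unfolding main 1 add_diff_eq[symmetric] 2 ..
  qed
  show ?thesis
    unfolding expand
  proof (intro sum_in_bigo(1) big_sum_in_bigo)
    fix i j assume ij: "i \<in> ?I" "j \<in> ?I"
    show "(\<lambda>\<beta>. (a h i * a g j / \<sigma> ^ (fst i + fst j)) * (\<beta> ^ (fst i + fst j) * (?S \<beta> i j - ?\<delta> i j)))
        \<in> O[at_right 0](\<lambda>\<beta>. \<beta> ^ e)"
    proof (cases "a h i * a g j = 0")
      case False
      then have "e \<le> fst i + fst j + off_order (fst i) (fst j)"
        by (intro e van[OF h ij(1)] van[OF g ij(2)]) auto
      then have *: "(\<lambda>\<beta>. \<beta> ^ (fst i + fst j) * \<beta> ^ off_order (fst i) (fst j)) \<in> O[at_right 0](\<lambda>\<beta>::real. \<beta> ^ e)"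
        unfolding power_add[symmetric] by (rule power_bigo_at_right_0)
      show ?thesis
        by (rule cmult_bigo, rule landau_o.big_trans[OF landau_o.big_mult[OF landau_o.big_refl R[OF ij]] *])
    qed auto
  next
    fix i assume i: "i \<in> ?I"
    show "(\<lambda>\<beta>. (if fst i = k \<and> k = l then 0 else a h i * a g i / fact (fst i) / \<sigma> ^ (2 * fst i)) * \<beta> ^ (2 * fst i))
        \<in> O[at_right 0](\<lambda>\<beta>. \<beta> ^ e)"
    proof (cases "(fst i = k \<and> k = l) \<or> a h i * a g i = 0")
      case False
      then have "e \<le> 2 * fst i"
        by (intro e' van[OF h i] van[OF g i]) auto
      then show ?thesis by (intro cmult_bigo power_bigo_at_right_0)
    qed auto
  qed
qed

end

theorem corollary4p8:
  fixes \<mu> :: "'z measure" and A :: "'z \<Rightarrow> real^'m^'d" and \<sigma> :: real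
    and \<Theta> :: "(real^'m) set" and \<theta>s :: "real^'m" and L :: nat
    and B :: "nat \<Rightarrow> 'd tensor set"
  assumes "prob_space \<mu>" and "A \<in> borel_measurable \<mu>" and "0 < \<sigma>"
    and "C2_submanifold CARD('m) \<Theta>" and "\<theta>s \<in> interior \<Theta>"
    and "condition_R \<mu> A \<Theta>" and "condition_Q \<mu> A \<Theta> \<theta>s"
    and "\<And>j. sym_orthonormal_basis j (B j)"
    and "r_loc \<mu> A \<Theta> \<theta>s \<le> enat L"
  shows "\<forall>k l h g. 1 \<le> k \<and> enat k \<le> r_loc \<mu> A \<Theta> \<theta>s \<and> 1 \<le> l \<and> enat l \<le> r_loc \<mu> A \<Theta> \<theta>s \<and>
      h \<in> layer_U \<mu> A \<Theta> \<theta>s k \<and> g \<in> layer_U \<mu> A \<Theta> \<theta>s l \<longrightarrow>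
      (k = l \<longrightarrow>
        (\<lambda>\<beta>. h \<bullet> gmom_info \<mu> A \<sigma> \<Theta> L B \<theta>s \<beta> g
              - snr \<sigma> \<beta> ^ k / fact k * frob k (DT \<mu> A \<theta>s k h) (DT \<mu> A \<theta>s k g))
          \<in> O[at_right 0](\<lambda>\<beta>. snr \<sigma> \<beta> ^ (k + 1))) \<and>
      (\<bar>int k - int l\<bar> = 1 \<longrightarrow>
        (\<lambda>\<beta>. h \<bullet> gmom_info \<mu> A \<sigma> \<Theta> L B \<theta>s \<beta> g)
          \<in> O[at_right 0](\<lambda>\<beta>. snr \<sigma> \<beta> powr (real (k + l + 1) / 2))) \<and>
      (\<bar>int k - int l\<bar> \<ge> 2 \<longrightarrow>
        (\<lambda>\<beta>. h \<bullet> gmom_info \<mu> A \<sigma> \<Theta> L B \<theta>s \<beta> g)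
          \<in> O[at_right 0](\<lambda>\<beta>. snr \<sigma> \<beta> powr (real (k + l + 2) / 2)))"
proof (intro allI impI, elim conjE)
  fix k l h g
  assume k: "1 \<le> k" "enat k \<le> r_loc \<mu> A \<Theta> \<theta>s"
    and hU: "h \<in> layer_U \<mu> A \<Theta> \<theta>s k" and gU: "g \<in> layer_U \<mu> A \<Theta> \<theta>s l"
  obtain amax where "AE z in \<mu>. onorm ((*v) (A z)) \<le> amax"
    using assms(6) by (auto simp: condition_R_def)
  then interpret linear_mixture \<mu> A \<sigma> amax
    using assms(1-3) by (simp add: linear_mixture_def linear_mixture_axioms_def)
  have "k \<le> L" using order_trans[OF k(2) assms(9)] by simp
  moreover have "h \<in> layer_V \<mu> A \<Theta> \<theta>s k" "g \<in> layer_V \<mu> A \<Theta> \<theta>s l"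
    using hU gU by (auto simp: layer_U_def)
  ultimately have X: "(\<lambda>\<beta>. h \<bullet> gmom_info \<mu> A \<sigma> \<Theta> L B \<theta>s \<beta> g
      - (if k = l then snr \<sigma> \<beta> ^ k / fact k * frob k (DT \<mu> A \<theta>s k h) (DT \<mu> A \<theta>s k g) else 0))
      \<in> O[at_right 0](\<lambda>\<beta>. \<beta> ^ e)"
    if "\<And>i j. k \<le> i \<Longrightarrow> l \<le> j \<Longrightarrow> e \<le> i + j + off_order i j"
      and "\<And>i. k \<le> i \<Longrightarrow> l \<le> i \<Longrightarrow> \<not> (i = k \<and> i = l) \<Longrightarrow> e \<le> 2 * i" for e
    using gmom_info_expansion[OF assms(8)] k(1) that by blast
  show "(k = l \<longrightarrow>
        (\<lambda>\<beta>. h \<bullet> gmom_info \<mu> A \<sigma> \<Theta> L B \<theta>s \<beta> g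
              - snr \<sigma> \<beta> ^ k / fact k * frob k (DT \<mu> A \<theta>s k h) (DT \<mu> A \<theta>s k g))
          \<in> O[at_right 0](\<lambda>\<beta>. snr \<sigma> \<beta> ^ (k + 1))) \<and>
      (\<bar>int k - int l\<bar> = 1 \<longrightarrow>
        (\<lambda>\<beta>. h \<bullet> gmom_info \<mu> A \<sigma> \<Theta> L B \<theta>s \<beta> g)
          \<in> O[at_right 0](\<lambda>\<beta>. snr \<sigma> \<beta> powr (real (k + l + 1) / 2))) \<and>
      (\<bar>int k - int l\<bar> \<ge> 2 \<longrightarrow>
        (\<lambda>\<beta>. h \<bullet> gmom_info \<mu> A \<sigma> \<Theta> L B \<theta>s \<beta> g)
          \<in> O[at_right 0](\<lambda>\<beta>. snr \<sigma> \<beta> powr (real (k + l + 2) / 2)))"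
  proof (intro conjI impI)
    assume kl: "k = l"
    define e where "e = 2 * (k + 1)"
    \<comment> \<open>Either \<open>i = j = k\<close> and \<open>off_order\<close> is
      \<open>2\<close>, or \<open>i + j \<ge> 2 * k + 1\<close> and \<open>off_order\<close> is at
      least \<open>1\<close>.\<close>
    have 1: "e \<le> i + j + off_order i j" if "k \<le> i" "l \<le> j" for i j
      using kl that by (auto simp: e_def off_order_def)
    have 2: "e \<le> 2 * i" if "k \<le> i" "l \<le> i" "\<not> (i = k \<and> i = l)" for i
      using kl that by (auto simp: e_def)
    show "(\<lambda>\<beta>. h \<bullet> gmom_info \<mu> A \<sigma> \<Theta> L B \<theta>s \<beta> g
              - snr \<sigma> \<beta> ^ k / fact k * frob k (DT \<mu> A \<theta>s k h) (DT \<mu> A \<theta>s k g))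
          \<in> O[at_right 0](\<lambda>\<beta>. snr \<sigma> \<beta> ^ (k + 1))"
      using X[OF 1 2] unfolding e_def if_P[OF kl] by (rule power_snr_bigo_even[OF \<sigma>_pos])
  next
    assume kl: "\<bar>int k - int l\<bar> = 1"
    then have ne: "k \<noteq> l" by auto
    define e where "e = k + l + 1"
    have 1: "e \<le> i + j + off_order i j" if "k \<le> i" "l \<le> j" for i j
      using kl that by (auto simp: e_def off_order_def)
    \<comment> \<open>The least diagonal index is \<open>max k l\<close>, and
      \<open>2 * max k l = k + l + 1\<close> for neighbouring layers.\<close>
    have 2: "e \<le> 2 * i" if "k \<le> i" "l \<le> i" "\<not> (i = k \<and> i = l)" for i
      using kl that by (auto simp: e_def)
    show "(\<lambda>\<beta>. h \<bullet> gmom_info \<mu> A \<sigma> \<Theta> L B \<theta>s \<beta> g)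
          \<in> O[at_right 0](\<lambda>\<beta>. snr \<sigma> \<beta> powr (real (k + l + 1) / 2))"
      using X[OF 1 2] unfolding e_def if_not_P[OF ne] diff_zero by (rule power_snr_bigo[OF \<sigma>_pos])
  next
    assume kl: "\<bar>int k - int l\<bar> \<ge> 2"
    then have ne: "k \<noteq> l" by auto
    define e where "e = k + l + 2"
    \<comment> \<open>At \<open>(k, l)\<close> itself \<open>off_order\<close> is \<open>2\<close>;
      at every other pair \<open>i + j\<close> has grown by at least one.\<close>
    have 1: "e \<le> i + j + off_order i j" if "k \<le> i" "l \<le> j" for i j
      using kl that by (auto simp: e_def off_order_def)
    have 2: "e \<le> 2 * i" if "k \<le> i" "l \<le> i" "\<not> (i = k \<and> i = l)" for i
      using kl that by (auto simp: e_def)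
    show "(\<lambda>\<beta>. h \<bullet> gmom_info \<mu> A \<sigma> \<Theta> L B \<theta>s \<beta> g)
          \<in> O[at_right 0](\<lambda>\<beta>. snr \<sigma> \<beta> powr (real (k + l + 2) / 2))"
      using X[OF 1 2] unfolding e_def if_not_P[OF ne] diff_zero by (rule power_snr_bigo[OF \<sigma>_pos])
  qed
qed

end
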